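(* Let $C:I\to\mathcal{Z}$ be a Legendre curve, let $\mathfrak{Q}^{2}$ be a 2-dimensional (Riemannian or Lorentzian) space form with point sphere complex $\mathfrak{p}$ and space form vector $\mathfrak{q}$, and let $\mathfrak{f}$, $\mathfrak{t}$ and $k$ be the corresponding point sphere map, tangent plane congruence and curvature. Then the curve $\mathfrak{f}$ is a constrained elastic curve in $\mathfrak{Q}^{2}$ if and only if the enveloped congruence $\langle \mathfrak{t}+\tfrac{k}{2}\mathfrak{f}\rangle$ of circles with geodesic curvature $\tfrac{k}{2}$ takes values in a fixed linear circle complex, i.e. if and only if there is a $1$-dimensional subspace $\langle\mathfrak{r}\rangle\le\mathbb{R}^{3,2}$ with $(\mathfrak{t}+\tfrac{k}{2}\mathfrak{f},\mathfrak{r})=0$ on $I$.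
   Context: Let $\mathbb{R}^{3,2}$ be $\mathbb{R}^5$ with a symmetric bilinear form $(\cdot,\cdot)$ of signature $(3,2)$, let $\mathcal{L}$ be its light cone and $\mathcal{Z}$ the Grassmannian of totally isotropic 2-planes. Points of $\mathbb{P}(\mathcal{L})$ represent oriented circles of 2-dimensional space forms. $I$ is an open interval. A smooth map $C:I\to\mathcal{Z}$ is identified with a rank 2 null subbundle of $I\times\mathbb{R}^{3,2}$; $C^{(1)}$ denotes the set of sections of $C$ and derivatives of sections of $C$. $C$ is a Legendre curve if $C^{(1)}\le C^\perp$ and, for any $x\in I$, if $X\in T_xI$ is such that $d\sigma(X)\in C$ for all $\sigma\in\Gamma C$, then $X=0$. Space forms: choose $\mathfrak{p}\in\mathbb{R}^{3,2}$ with $\chi:=-(\mathfrak{p},\mathfrak{p})=\pm1$ (point sphere complex) and a non-zero $\mathfrak{q}\in\langle\mathfrak{p}\rangle^\perp$ (space form vector). Then $\mathfrak{Q}^2:=\{y\in\mathcal{L}:(y,\mathfrak{q})=-1,(y,\mathfrak{p})=0\}$ is a space form of constant sectional curvature $\kappa=-(\mathfrak{q},\mathfrak{q})$, Riemannian if $\chi=1$ and Lorentzian if $\chi=-1$, and $\mathfrak{P}^2:=\{y\in\mathcal{L}:(y,\mathfrak{p})=-1,(y,\mathfrak{q})=0\}$. The point sphere map is $\mathfrak{f}:=C\cap\mathfrak{Q}^2$ and the tangent plane congruence is $\mathfrak{t}:=C\cap\mathfrak{P}^2$. The curvature $k$ of $\mathfrak{f}$ is defined by $d\mathfrak{t}=-k\,d\mathfrak{f}$.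 With $'$ denoting differentiation with respect to the arclength parameter of $\mathfrak{f}$, the curve $\mathfrak{f}$ is a constrained elastic curve in $\mathfrak{Q}^2$ if and only if $k''+\chi\tfrac{k^3}{2}+(\mu+\kappa)k+\lambda=0$ for some constants $\mu,\lambda\in\mathbb{R}$. A 1-dimensional subspace $L\le\mathbb{R}^{3,2}$ defines the linear circle (sphere) complex $E_L:=\mathbb{P}(\mathcal{L})\cap L^\perp$. *)

theory Defs
  imports "HOL-Analysis.Analysis"
begin

definition has_signature ::
  "('v::euclidean_space \<Rightarrow> 'v \<Rightarrow> real) \<Rightarrow> nat \<Rightarrow> nat \<Rightarrow> bool" where
  "has_signature B m n \<longleftrightarrow>
     (\<exists>P N. card P = m \<and> card N = n \<and> P \<inter> N = {} \<and>
            independent (P \<union> N) \<and> span (P \<union> N) = UNIV \<and>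
            (\<forall>u\<in>P \<union> N. \<forall>v\<in>P \<union> N. u \<noteq> v \<longrightarrow> B u v = 0) \<and>
            (\<forall>u\<in>P. B u u = 1) \<and> (\<forall>u\<in>N. B u u = -1))"

definition pseudo_metric ::
  "('v::euclidean_space \<Rightarrow> 'v \<Rightarrow> real) \<Rightarrow> nat \<Rightarrow> nat \<Rightarrow> bool" where
  "pseudo_metric B m n \<longleftrightarrow>
     bilinear B \<and> (\<forall>u v. B u v = B v u) \<and> has_signature B m n"

definition perp ::
  "('v::euclidean_space \<Rightarrow> 'v \<Rightarrow> real) \<Rightarrow> 'v set \<Rightarrow> 'v set" where
  "perp B V = {y. \<forall>v\<in>V. B y v = 0}"

definition light_cone ::
  "('v::euclidean_space \<Rightarrow> 'v \<Rightarrow> real) \<Rightarrow> 'v set" where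
  "light_cone B = {y. y \<noteq> 0 \<and> B y y = 0}"

text \<open>The projectivised light cone, a point being the null line it spans.\<close>

definition proj_light_cone ::
  "('v::euclidean_space \<Rightarrow> 'v \<Rightarrow> real) \<Rightarrow> 'v set set" where
  "proj_light_cone B = {span {y} | y. y \<in> light_cone B}"

definition null_planes ::
  "('v::euclidean_space \<Rightarrow> 'v \<Rightarrow> real) \<Rightarrow> 'v set set" where
  "null_planes B = {V. subspace V \<and> dim V = 2 \<and> (\<forall>u\<in>V. \<forall>v\<in>V. B u v = 0)}"

definition linear_complex ::
  "('v::euclidean_space \<Rightarrow> 'v \<Rightarrow> real) \<Rightarrow> 'v set \<Rightarrow> 'v set set" where
  "linear_complex B L = {l \<in> proj_light_cone B. l \<subseteq> perp B L}"

text \<open>Smoothness (of class C-infinity) is only used on open sets, where the two-sided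
  derivative is the right one and values outside the set are irrelevant.\<close>

definition smooth_curve_on :: "real set \<Rightarrow> (real \<Rightarrow> 'v::euclidean_space) \<Rightarrow> bool" where
  "smooth_curve_on S g \<longleftrightarrow>
     (\<forall>n. \<forall>x\<in>S. ((\<lambda>h y. vector_derivative h (at y)) ^^ n) g differentiable (at x))"

text \<open>A smooth map into the Grassmannian of null planes, seen as a rank 2 null subbundle;
  smoothness means that the planes are locally spanned by smooth frames.\<close>

definition smooth_null_plane_curve ::
  "('v::euclidean_space \<Rightarrow> 'v \<Rightarrow> real) \<Rightarrow> real set \<Rightarrow> (real \<Rightarrow> 'v set) \<Rightarrow> bool" where
  "smooth_null_plane_curve B I C \<longleftrightarrow>
     (\<forall>x\<in>I. C x \<in> null_planes B) \<and>
     (\<forall>x\<in>I. \<exists>U \<sigma> \<tau>. open U \<and> x \<in> U \<and> U \<subseteq> I \<and>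
        smooth_curve_on U \<sigma> \<and> smooth_curve_on U \<tau> \<and>
        (\<forall>y\<in>U. C y = span {\<sigma> y, \<tau> y}))"

definition bundle_sections ::
  "real set \<Rightarrow> (real \<Rightarrow> 'v::euclidean_space set) \<Rightarrow> (real \<Rightarrow> 'v) set" where
  "bundle_sections I C = {\<sigma>. smooth_curve_on I \<sigma> \<and> (\<forall>x\<in>I. \<sigma> x \<in> C x)}"

text \<open>The fibre at x of the set of sections and derivatives of sections.\<close>

definition derived_fibre ::
  "real set \<Rightarrow> (real \<Rightarrow> 'v::euclidean_space set) \<Rightarrow> real \<Rightarrow> 'v set" where
  "derived_fibre I C x =
     {\<sigma> x | \<sigma>. \<sigma> \<in> bundle_sections I C} \<union>
     {vector_derivative \<sigma> (at x) | \<sigma>. \<sigma> \<in> bundle_sections I C}"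

text \<open>A tangent vector X of the interval is a real number, on which the differential of a
  section takes the value X times the derivative.\<close>

definition legendre_curve ::
  "('v::euclidean_space \<Rightarrow> 'v \<Rightarrow> real) \<Rightarrow> real set \<Rightarrow> (real \<Rightarrow> 'v set) \<Rightarrow> bool" where
  "legendre_curve B I C \<longleftrightarrow>
     smooth_null_plane_curve B I C \<and>
     (\<forall>x\<in>I. derived_fibre I C x \<subseteq> perp B (C x)) \<and>
     (\<forall>x\<in>I. \<forall>X::real.
        (\<forall>\<sigma>\<in>bundle_sections I C. X *\<^sub>R vector_derivative \<sigma> (at x) \<in> C x) \<longrightarrow> X = 0)"

definition space_form_point_set ::
  "('v::euclidean_space \<Rightarrow> 'v \<Rightarrow> real) \<Rightarrow> 'v \<Rightarrow> 'v \<Rightarrow> 'v set" where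
  "space_form_point_set B p q = {y \<in> light_cone B. B y q = -1 \<and> B y p = 0}"

definition space_form_plane_set ::
  "('v::euclidean_space \<Rightarrow> 'v \<Rightarrow> real) \<Rightarrow> 'v \<Rightarrow> 'v \<Rightarrow> 'v set" where
  "space_form_plane_set B p q = {y \<in> light_cone B. B y p = -1 \<and> B y q = 0}"

definition point_sphere_map ::
  "('v::euclidean_space \<Rightarrow> 'v \<Rightarrow> real) \<Rightarrow> 'v \<Rightarrow> 'v \<Rightarrow> real set \<Rightarrow>
   (real \<Rightarrow> 'v set) \<Rightarrow> (real \<Rightarrow> 'v) \<Rightarrow> bool" where
  "point_sphere_map B p q I C f \<longleftrightarrow> (\<forall>x\<in>I. C x \<inter> space_form_point_set B p q = {f x})"

definition tangent_plane_congruence ::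
  "('v::euclidean_space \<Rightarrow> 'v \<Rightarrow> real) \<Rightarrow> 'v \<Rightarrow> 'v \<Rightarrow> real set \<Rightarrow>
   (real \<Rightarrow> 'v set) \<Rightarrow> (real \<Rightarrow> 'v) \<Rightarrow> bool" where
  "tangent_plane_congruence B p q I C t \<longleftrightarrow>
     (\<forall>x\<in>I. C x \<inter> space_form_plane_set B p q = {t x})"

text \<open>For the point sphere map and tangent plane congruence of a Legendre curve, the
  existence of such a function k forces the point sphere map to be an immersion, and then k
  is unique and smooth on the interval.\<close>

definition curvature_function ::
  "real set \<Rightarrow> (real \<Rightarrow> 'v::euclidean_space) \<Rightarrow> (real \<Rightarrow> 'v) \<Rightarrow> (real \<Rightarrow> real) \<Rightarrow> bool" where
  "curvature_function I f t k \<longleftrightarrow>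
     (\<forall>x\<in>I. vector_derivative t (at x) = - (k x *\<^sub>R vector_derivative f (at x)))"

definition speed ::
  "('v::euclidean_space \<Rightarrow> 'v \<Rightarrow> real) \<Rightarrow> (real \<Rightarrow> 'v) \<Rightarrow> real \<Rightarrow> real" where
  "speed B f x = sqrt \<bar>B (vector_derivative f (at x)) (vector_derivative f (at x))\<bar>"

text \<open>Differentiation with respect to an arclength parameter s of f, by the chain rule with
  ds = speed dx.\<close>

definition arclength_deriv ::
  "('v::euclidean_space \<Rightarrow> 'v \<Rightarrow> real) \<Rightarrow> (real \<Rightarrow> 'v) \<Rightarrow> (real \<Rightarrow> real) \<Rightarrow> real \<Rightarrow> real" where
  "arclength_deriv B f h x = deriv h x / speed B f x"

definition space_form_sign :: "('v::euclidean_space \<Rightarrow> 'v \<Rightarrow> real) \<Rightarrow> 'v \<Rightarrow> real" where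
  "space_form_sign B p = - B p p"

definition space_form_curvature :: "('v::euclidean_space \<Rightarrow> 'v \<Rightarrow> real) \<Rightarrow> 'v \<Rightarrow> real" where
  "space_form_curvature B q = - B q q"

text \<open>The Euler--Lagrange equation for the bending energy, with constant multipliers for length and
  enclosed area, serves as the definition.\<close>

definition constrained_elastic ::
  "('v::euclidean_space \<Rightarrow> 'v \<Rightarrow> real) \<Rightarrow> 'v \<Rightarrow> 'v \<Rightarrow> real set \<Rightarrow>
   (real \<Rightarrow> 'v) \<Rightarrow> (real \<Rightarrow> real) \<Rightarrow> bool" where
  "constrained_elastic B p q I f k \<longleftrightarrow>
     (\<exists>(\<mu>::real) (l::real). \<forall>x\<in>I.
        arclength_deriv B f (arclength_deriv B f k) x
          + space_form_sign B p * (k x) ^ 3 / 2 + (\<mu> + space_form_curvature B q) * k x + l = 0)"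

text \<open>The enveloped circles of geodesic curvature m, given pointwise as null lines: a null
  vector c with (c,p) = -1 represents an oriented circle of geodesic curvature -(c,q).\<close>

definition circle_congruence ::
  "(real \<Rightarrow> 'v::euclidean_space) \<Rightarrow> (real \<Rightarrow> 'v) \<Rightarrow> (real \<Rightarrow> real) \<Rightarrow> real \<Rightarrow> 'v set" where
  "circle_congruence f t m x = span {t x + m x *\<^sub>R f x}"

end

theory Submission
  imports Defs
begin

text \<open>
  Write \<open>\<eta> = -(p,p)\<close> and \<open>\<kappa> = -(q,q)\<close>, let \<open>v\<close> be the speed of \<open>f\<close> and \<open>n = f'/v\<close> its unit tangent; a dot
  stands for the arclength derivative. The vectors \<open>f, t, p, q\<close> have a constant nondegenerate
  Gram matrix of signature \<open>(2,2)\<close>, and the Legendre condition makes \<open>n\<close> orthogonal to them. In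
  signature \<open>(3,2)\<close> this forces \<open>(f',f') > 0\<close>, hence \<open>(n,n) = 1\<close> (lemma \<open>normal_spacelike\<close>), so that
  \<open>f, t, n, p, q\<close> is a frame, and differentiating its inner products gives the structure equations
  (lemma \<open>deriv_n\<close>)
  \[ \dot f = n, \qquad \dot t = -k n, \qquad \dot n = -\kappa f + \eta k t - k p + q. \]

  If \<open>f\<close> is constrained elastic with multipliers \<open>\<mu>, \<lambda>\<close>, then the vector \<open>r\<close> with
  \<open>(r,f) = k\<close>, \<open>(r,t) = -k^2/2\<close>, \<open>(r,p) = \<mu>\<close>, \<open>(r,q) = -\<lambda>\<close> and \<open>(r,n)\<close> the arclength derivative of \<open>k\<close> is
  constant along the curve, because its derivative is the Euler-Lagrange expression times \<open>n\<close>; it is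
  orthogonal to \<open>t + (k/2) f\<close>, and nonzero if \<open>k\<close> is nonzero somewhere. If \<open>k\<close> vanishes identically, \<open>q\<close> serves
  instead (lemma \<open>elastic_imp_complex\<close>).

  Conversely let \<open>r \<noteq> 0\<close> be constant and orthogonal to \<open>t + (k/2) f\<close>. Put \<open>F = (f,r)\<close>,
  \<open>N = (n,r)\<close>, \<open>P = (p,r)\<close>, \<open>Q = (q,r)\<close>. Differentiating \<open>(t,r) = -k F / 2\<close> shows that the
  Wronskian of \<open>k\<close> and \<open>F\<close> vanishes, while the structure equations give
  \[ \dot F = N, \qquad \dot N = Q - P k - (\kappa + \eta k^2/2) F. \]
  Where \<open>F = \<rho> k\<close> with a constant \<open>\<rho> \<noteq> 0\<close>, this is \<open>\<rho>\<close> times the Euler-Lagrange equation. A vanishing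
  Wronskian alone does not make \<open>k\<close> and \<open>F\<close> proportional across their common zeros, and this is
  the delicate point. Suppose that an interval on which \<open>F = \<rho> k\<close> with \<open>F\<close> not identically zero ends at a
  common zero. If \<open>N\<close> vanished there as well and \<open>Q = 0\<close>, uniqueness for a linear equation would
  give \<open>F = 0\<close> on the interval (lemma \<open>no_double_zero\<close>). Otherwise \<open>F\<close> is nonzero just beyond the zero, and
  the ratios on both sides agree because they are the ratio of the first or second derivatives
  (lemma \<open>extend_right\<close>). So proportionality spreads from one
  point with \<open>k \<noteq> 0\<close> over the interval. If \<open>F\<close> vanishes at a point with \<open>k \<noteq> 0\<close>, then
  \<open>k\<close> is the constant \<open>Q/P\<close> (lemma \<open>constant_of_zero\<close>), and a curve of constant curvature is
  elastic.
\<close>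

section \<open>Finite orders of differentiability\<close>

text \<open>Existence of \<open>n\<close> successive derivatives at all points of \<open>S\<close>. Stating it through some derivative
  \<open>g'\<close> rather than through the operator \<open>vector_derivative\<close> makes the closure properties plain
  inductions on \<open>n\<close>.\<close>

primrec times_differentiable_on ::
    "nat \<Rightarrow> real set \<Rightarrow> (real \<Rightarrow> 'v::real_normed_vector) \<Rightarrow> bool" where
  "times_differentiable_on 0 S g = True"
| "times_differentiable_on (Suc n) S g =
     (\<exists>g'. (\<forall>x\<in>S. (g has_vector_derivative g' x) (at x)) \<and> times_differentiable_on n S g')"

lemma times_differentiable_on_Suc_imp:
  "times_differentiable_on (Suc n) S g \<Longrightarrow> times_differentiable_on n S g"
proof (induction n arbitrary: g)
  case (Suc n)
  then show ?case by (metis times_differentiable_on.simps(2))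
qed simp

lemma times_differentiable_on_const: "times_differentiable_on n S (\<lambda>_. c)"
proof (induction n arbitrary: c)
  case (Suc n)
  then show ?case by (auto intro!: exI[of _ "\<lambda>_. 0"] simp: has_vector_derivative_const)
qed simp

lemma times_differentiable_on_add:
  "times_differentiable_on n S g \<Longrightarrow> times_differentiable_on n S h \<Longrightarrow>
   times_differentiable_on n S (\<lambda>x. g x + h x)"
proof (induction n arbitrary: g h)
  case (Suc n)
  then obtain g' h' where
    "\<forall>x\<in>S. (g has_vector_derivative g' x) (at x)" "times_differentiable_on n S g'"
    "\<forall>x\<in>S. (h has_vector_derivative h' x) (at x)" "times_differentiable_on n S h'"
    by auto
  with Suc.IH show ?case
    by (auto intro!: exI[of _ "\<lambda>x. g' x + h' x"] has_vector_derivative_add)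
qed simp

lemma times_differentiable_on_bilinear:
  assumes "bounded_bilinear bl"
  shows "times_differentiable_on n S g \<Longrightarrow> times_differentiable_on n S h \<Longrightarrow>
   times_differentiable_on n S (\<lambda>x. bl (g x) (h x))"
proof (induction n arbitrary: g h)
  case (Suc n)
  then obtain g' h' where d:
    "\<forall>x\<in>S. (g has_vector_derivative g' x) (at x)" "times_differentiable_on n S g'"
    "\<forall>x\<in>S. (h has_vector_derivative h' x) (at x)" "times_differentiable_on n S h'"
    by auto
  have "times_differentiable_on n S g" "times_differentiable_on n S h"
    using Suc.prems by (auto dest!: times_differentiable_on_Suc_imp simp del: times_differentiable_on.simps)
  with Suc.IH d show ?case
    by (auto intro!: exI[of _ "\<lambda>x. bl (g x) (h' x) + bl (g' x) (h x)"] bounded_bilinear.has_vector_derivative[OF assms]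
        times_differentiable_on_add)
qed simp

lemma times_differentiable_on_inverse:
  fixes h :: "real \<Rightarrow> real"
  assumes "\<And>x. x \<in> S \<Longrightarrow> h x \<noteq> 0"
  shows "times_differentiable_on n S h \<Longrightarrow> times_differentiable_on n S (\<lambda>x. inverse (h x))"
proof (induction n)
  case (Suc n)
  then obtain h' where d:
    "\<forall>x\<in>S. (h has_vector_derivative h' x) (at x)" "times_differentiable_on n S h'"
    by auto
  have inv: "times_differentiable_on n S (\<lambda>x. inverse (h x))"
    using Suc by (auto dest!: times_differentiable_on_Suc_imp simp del: times_differentiable_on.simps)
  show ?case
    unfolding times_differentiable_on.simps
  proof (intro exI conjI ballI)
    show "times_differentiable_on n S (\<lambda>x. (- 1) * (inverse (h x) * (h' x * inverse (h x))))"
      by (intro times_differentiable_on_bilinear[OF bounded_bilinear_mult] inv d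
          times_differentiable_on_const)
    fix x assume "x \<in> S"
    then have "(h has_field_derivative h' x) (at x)" "h x \<noteq> 0"
      using d assms by (auto simp: has_real_derivative_iff_has_vector_derivative)
    from DERIV_inverse'[OF this]
    show "((\<lambda>x. inverse (h x)) has_vector_derivative (- 1) * (inverse (h x) * (h' x * inverse (h x)))) (at x)"
      by (simp add: has_real_derivative_iff_has_vector_derivative mult.assoc)
  qed
qed simp

lemma times_differentiable_on_cong:
  assumes "open S" "\<And>x. x \<in> S \<Longrightarrow> g x = h x"
  shows "times_differentiable_on n S g \<longleftrightarrow> times_differentiable_on n S h"
proof (cases n)
  case (Suc j)
  have "(g has_vector_derivative d) (at x) \<longleftrightarrow> (h has_vector_derivative d) (at x)" if "x \<in> S" for x d
    using that assms by (metis has_vector_derivative_transform_within_open)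
  then show ?thesis using Suc by simp
qed simp

lemma smooth_curve_on_iff_times_differentiable_on:
  fixes g :: "real \<Rightarrow> 'v::euclidean_space"
  assumes "open S"
  shows "smooth_curve_on S g \<longleftrightarrow> (\<forall>n. times_differentiable_on n S g)"
proof
  define D :: "(real \<Rightarrow> 'v) \<Rightarrow> real \<Rightarrow> 'v" where "D = (\<lambda>h y. vector_derivative h (at y))"
  have smooth: "smooth_curve_on S g \<longleftrightarrow> (\<forall>n. \<forall>x\<in>S. (D ^^ n) g differentiable at x)" for g :: "real \<Rightarrow> 'v"
    by (simp add: smooth_curve_on_def D_def)
  have "\<forall>g :: real \<Rightarrow> 'v. smooth_curve_on S g \<longrightarrow> times_differentiable_on n S g" for n
  proof (induction n)
    case (Suc n)
    show ?case
    proof (intro allI impI)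
      fix g :: "real \<Rightarrow> 'v" assume g: "smooth_curve_on S g"
      have "smooth_curve_on S (D g)"
        unfolding smooth using g[unfolded smooth] by (metis funpow_swap1 funpow_simps_right(2) comp_apply)
      moreover have "(g has_vector_derivative D g x) (at x)" if "x \<in> S" for x
        using g[unfolded smooth, rule_format, OF that, of 0] unfolding D_def
        by (simp add: vector_derivative_works)
      ultimately show "times_differentiable_on (Suc n) S g" using Suc by auto
    qed
  qed simp
  then show "smooth_curve_on S g \<Longrightarrow> \<forall>n. times_differentiable_on n S g" by blast
  have "\<forall>g. times_differentiable_on (Suc n) S g \<longrightarrow> (\<forall>x\<in>S. (D ^^ n) g differentiable at x)" for n
  proof (induction n)
    case 0
    then show ?case by (auto intro: differentiableI_vector)
  next
    case (Suc n)
    show ?case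
    proof (intro allI impI)
      fix g :: "real \<Rightarrow> 'v" assume "times_differentiable_on (Suc (Suc n)) S g"
      then obtain g' where g': "\<And>x. x \<in> S \<Longrightarrow> (g has_vector_derivative g' x) (at x)"
        "times_differentiable_on (Suc n) S g'" by (metis times_differentiable_on.simps(2))
      have "D g x = g' x" if "x \<in> S" for x
        using g'(1)[OF that] by (simp add: D_def vector_derivative_at)
      then have "times_differentiable_on (Suc n) S (D g)"
        using times_differentiable_on_cong[OF assms] g'(2) by blast
      then have "\<forall>x\<in>S. (D ^^ n) (D g) differentiable at x" using Suc by blast
      then show "\<forall>x\<in>S. (D ^^ Suc n) g differentiable at x"
        by (simp add: funpow_swap1)
    qed
  qed
  then show "\<forall>n. times_differentiable_on n S g \<Longrightarrow> smooth_curve_on S g"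
    unfolding smooth by blast
qed

section \<open>Scalar systems with vanishing Wronskian\<close>

lemma DERIV_zero_of_vanishing:
  fixes g :: "real \<Rightarrow> real"
  assumes "(g has_real_derivative D) (at x)" "a < b" "x \<in> {a..b}" "\<And>z. z \<in> {a..b} \<Longrightarrow> g z = 0"
  shows "D = 0"
proof -
  have "(g has_vector_derivative D) (at x within cbox a b)"
    using assms(1) has_real_derivative_iff_has_vector_derivative has_vector_derivative_at_within by blast
  moreover have "(g has_vector_derivative 0) (at x within cbox a b)"
    by (rule has_vector_derivative_transform[OF _ _ has_vector_derivative_const[of 0]]) (use assms(3,4) in auto)
  ultimately show ?thesis
    using vector_derivative_unique_within_closed_interval[of a b x g D 0] assms by auto
qed

text \<open>Backward Gronwall estimate: the bound makes \<open>H(x) exp (K x)\<close> nondecreasing.\<close>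

lemma vanishing_of_growth_bound:
  fixes H :: "real \<Rightarrow> real"
  assumes "a \<le> b" and "\<And>x. x \<in> {a..b} \<Longrightarrow> (H has_real_derivative H' x) (at x)"
    and "\<And>x. x \<in> {a..b} \<Longrightarrow> \<bar>H' x\<bar> \<le> K * H x" and "H b = 0"
  shows "H a \<le> 0"
proof -
  have "H a * exp (K * a) \<le> H b * exp (K * b)"
  proof (rule DERIV_nonneg_imp_nondecreasing[OF assms(1)])
    fix x assume "a \<le> x" "x \<le> b"
    then have x: "x \<in> {a..b}" by simp
    have "((\<lambda>x. H x * exp (K * x)) has_real_derivative (H' x + K * H x) * exp (K * x)) (at x)"
      by (auto intro!: derivative_eq_intros assms(2)[OF x] simp: algebra_simps)
    moreover have "0 \<le> (H' x + K * H x) * exp (K * x)"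
      using assms(3)[OF x] by (intro mult_nonneg_nonneg) auto
    ultimately show "\<exists>y. ((\<lambda>x. H x * exp (K * x)) has_real_derivative y) (at x) \<and> 0 \<le> y" by blast
  qed
  then show ?thesis using assms(4) by (simp add: mult_le_0_iff)
qed

lemma DERIV_nonzero_imp_nonzero_right:
  fixes g :: "real \<Rightarrow> real"
  assumes "(g has_real_derivative D) (at b)" "D \<noteq> 0" "g b = 0"
  shows "\<exists>\<epsilon>>0. \<forall>x\<in>{b<..<b + \<epsilon>}. g x \<noteq> 0"
proof -
  have "\<exists>d>0. \<forall>h>0. h < d \<longrightarrow> g (b + h) \<noteq> 0"
  proof (cases "D > 0")
    case True
    from DERIV_pos_inc_right[OF assms(1) True] show ?thesis using assms(3) by force
  next
    case False
    then have "D < 0" using assms(2) by simp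
    from DERIV_neg_dec_right[OF assms(1) this] show ?thesis using assms(3) by force
  qed
  then obtain d where "d > 0" and d: "\<And>h. h > 0 \<Longrightarrow> h < d \<Longrightarrow> g (b + h) \<noteq> 0" by blast
  have "g x \<noteq> 0" if "x \<in> {b<..<b + d}" for x
    using d[of "x - b"] that by simp
  with \<open>d > 0\<close> show ?thesis by blast
qed

lemma proportional_if_wronskian_zero:
  fixes g h :: "real \<Rightarrow> real"
  assumes "convex S"
    and "\<And>x. x \<in> S \<Longrightarrow> (g has_real_derivative g' x) (at x)"
    and "\<And>x. x \<in> S \<Longrightarrow> (h has_real_derivative h' x) (at x)"
    and "\<And>x. x \<in> S \<Longrightarrow> g' x * h x = g x * h' x" and "\<And>x. x \<in> S \<Longrightarrow> h x \<noteq> 0"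
  shows "\<exists>c. \<forall>x\<in>S. g x = c * h x"
proof -
  have "\<exists>c. \<forall>x\<in>S. g x / h x = c"
  proof (rule has_field_derivative_zero_constant[OF assms(1)])
    fix x assume x: "x \<in> S"
    from DERIV_divide[OF assms(2)[OF x] assms(3)[OF x] assms(5)[OF x]] assms(4)[OF x]
    show "((\<lambda>x. g x / h x) has_real_derivative 0) (at x within S)"
      by (simp add: has_field_derivative_at_within)
  qed
  then show ?thesis using assms(5) by (metis nonzero_eq_divide_eq)
qed

text \<open>The equations satisfied by \<open>F = (f,r)\<close> and \<open>N = (n,r)\<close> for a constant vector \<open>r\<close>, where \<open>P = (p,r)\<close> and
  \<open>Q = (q,r)\<close>, in a parameter of speed \<open>v\<close>; \<open>m\<close> is the arclength derivative of \<open>k\<close>.\<close>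

locale wronskian_system =
  fixes I :: "real set" and F N k m v :: "real \<Rightarrow> real" and \<kappa> \<eta> P Q :: real
  assumes open_I: "open I" and interval_I: "is_interval I"
    and DERIV_F: "\<And>x. x \<in> I \<Longrightarrow> (F has_real_derivative v x * N x) (at x)"
    and DERIV_N: "\<And>x. x \<in> I \<Longrightarrow>
      (N has_real_derivative v x * (Q - P * k x - (\<kappa> + \<eta> * (k x)^2 / 2) * F x)) (at x)"
    and DERIV_k: "\<And>x. x \<in> I \<Longrightarrow> (k has_real_derivative v x * m x) (at x)"
    and differentiable_m: "\<And>x. x \<in> I \<Longrightarrow> m differentiable (at x)"
    and v_pos: "\<And>x. x \<in> I \<Longrightarrow> v x > 0" and continuous_v: "continuous_on I v"
    and wronskian: "\<And>x. x \<in> I \<Longrightarrow> k x * N x = m x * F x"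
begin

lemma interval_subset: "a \<in> I \<Longrightarrow> b \<in> I \<Longrightarrow> {a..b} \<subseteq> I"
  using interval_I by (meson atLeastAtMost_iff is_interval_1 subsetI)

lemma continuous: "continuous_on I F" "continuous_on I N" "continuous_on I k"
  using DERIV_F DERIV_N DERIV_k by (meson DERIV_isCont continuous_at_imp_continuous_on)+

lemma ratio_constant:
  assumes "convex S" "S \<subseteq> I" "\<And>x. x \<in> S \<Longrightarrow> F x \<noteq> 0"
  shows "\<exists>c. \<forall>x\<in>S. k x = c * F x"
proof (rule proportional_if_wronskian_zero[OF assms(1)])
  fix x assume "x \<in> S"
  then have x: "x \<in> I" using assms(2) by auto
  show "(k has_real_derivative v x * m x) (at x)" by (rule DERIV_k[OF x])
  show "(F has_real_derivative v x * N x) (at x)" by (rule DERIV_F[OF x])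
  show "v x * m x * F x = k x * (v x * N x)" using wronskian[OF x] by (simp add: algebra_simps)
qed (use assms(3) in auto)

lemma ratio_constant_inverse:
  assumes "convex S" "S \<subseteq> I" "\<And>x. x \<in> S \<Longrightarrow> k x \<noteq> 0"
  shows "\<exists>c. \<forall>x\<in>S. F x = c * k x"
proof (rule proportional_if_wronskian_zero[OF assms(1)])
  fix x assume "x \<in> S"
  then have x: "x \<in> I" using assms(2) by auto
  show "(k has_real_derivative v x * m x) (at x)" by (rule DERIV_k[OF x])
  show "(F has_real_derivative v x * N x) (at x)" by (rule DERIV_F[OF x])
  show "v x * N x * k x = F x * (v x * m x)" using wronskian[OF x] by (simp add: algebra_simps)
qed (use assms(3) in auto)

text \<open>On a nondegenerate interval a proportionality can be differentiated twice, also at the end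
  points, where it is known on one side only.\<close>

lemma proportional_derivatives:
  assumes "a < b" "{a..b} \<subseteq> I" "\<And>x. x \<in> {a..b} \<Longrightarrow> k x = c * F x" and x: "x \<in> {a..b}"
  shows "m x = c * N x"
    and "deriv m x = c * (v x * (Q - P * k x - (\<kappa> + \<eta> * (k x)^2 / 2) * F x))"
proof -
  have m: "m z = c * N z" if z: "z \<in> {a..b}" for z
  proof -
    have zI: "z \<in> I" using assms z by auto
    have "((\<lambda>z. k z - c * F z) has_real_derivative v z * m z - c * (v z * N z)) (at z)"
      by (intro derivative_intros DERIV_k DERIV_F DERIV_cmult zI)
    from DERIV_zero_of_vanishing[OF this assms(1) z] assms(3)
    have "v z * (m z - c * N z) = 0" by (simp add: algebra_simps)
    then show ?thesis using v_pos[OF zI] by simp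
  qed
  show "m x = c * N x" by (rule m[OF x])
  have xI: "x \<in> I" using assms by auto
  have "((\<lambda>z. m z - c * N z) has_real_derivative
      deriv m x - c * (v x * (Q - P * k x - (\<kappa> + \<eta> * (k x)^2 / 2) * F x))) (at x)"
    using differentiable_m[OF xI]
    by (intro derivative_intros DERIV_N DERIV_cmult xI) (simp add: DERIV_deriv_iff_real_differentiable)
  from DERIV_zero_of_vanishing[OF this assms(1) x] m
  show "deriv m x = c * (v x * (Q - P * k x - (\<kappa> + \<eta> * (k x)^2 / 2) * F x))" by simp
qed

text \<open>While \<open>F = \<rho> k\<close> and \<open>Q = 0\<close>, the pair \<open>(F, N)\<close> solves a homogeneous linear system, so it cannot reach
  zero from nonzero data.\<close>

lemma no_double_zero:
  assumes "a \<le> b" "a \<in> I" "b \<in> I" "\<rho> \<noteq> 0" "\<And>x. x \<in> {a..b} \<Longrightarrow> F x = \<rho> * k x"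
    and "F a \<noteq> 0" "F b = 0"
  shows "N b \<noteq> 0 \<or> Q \<noteq> 0"
proof (rule ccontr)
  assume "\<not> ?thesis"
  then have N: "N b = 0" and Q: "Q = 0" by auto
  have ab: "{a..b} \<subseteq> I" using interval_subset assms by blast
  define \<beta> where "\<beta> x = v x * (1 - P / \<rho> - \<kappa> - \<eta> * (k x)^2 / 2)" for x
  have "continuous_on {a..b} \<beta>"
    unfolding \<beta>_def
    by (intro continuous_intros continuous_on_subset[OF continuous(3) ab]
        continuous_on_subset[OF continuous_v ab]) auto
  then have "bounded (\<beta> ` {a..b})"
    by (intro compact_imp_bounded compact_continuous_image) auto
  then obtain K where K: "\<And>x. x \<in> {a..b} \<Longrightarrow> \<bar>\<beta> x\<bar> \<le> K"
    by (metis bounded_real image_eqI)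
  have "F a ^ 2 + N a ^ 2 \<le> 0"
  proof (rule vanishing_of_growth_bound[OF assms(1)])
    fix x assume x: "x \<in> {a..b}"
    then have xI: "x \<in> I" using ab by auto
    have kx: "k x = F x / \<rho>" using assms(4,5) x by simp
    have "2 * F x * (v x * N x) + 2 * N x * (v x * (Q - P * k x - (\<kappa> + \<eta> * (k x)^2 / 2) * F x))
        = 2 * F x * N x * \<beta> x"
      unfolding \<beta>_def Q using assms(4) by (simp add: kx field_simps)
    then show "((\<lambda>x. F x ^ 2 + N x ^ 2) has_real_derivative 2 * F x * N x * \<beta> x) (at x)"
      by (auto intro!: derivative_eq_intros DERIV_F[OF xI] DERIV_N[OF xI] simp: algebra_simps)
    have "\<bar>2 * F x * N x * \<beta> x\<bar> = \<bar>2 * F x * N x\<bar> * \<bar>\<beta> x\<bar>" by (simp add: abs_mult)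
    also have "\<dots> \<le> (F x ^ 2 + N x ^ 2) * K"
    proof (intro mult_mono K x)
      show "\<bar>2 * F x * N x\<bar> \<le> F x ^ 2 + N x ^ 2"
        using zero_le_power2[of "F x + N x"] zero_le_power2[of "F x - N x"]
        by (simp add: power2_sum power2_diff abs_le_iff)
    qed auto
    finally show "\<bar>2 * F x * N x * \<beta> x\<bar> \<le> K * (F x ^ 2 + N x ^ 2)" by (simp add: mult.commute)
  qed (use assms N in auto)
  then show False using assms(6) by (simp add: sum_power2_le_zero_iff)
qed

lemma ball_subset:
  assumes "b \<in> I" obtains e where "e > 0" "{b - e<..<b + e} \<subseteq> I"
proof -
  obtain e where "e > 0" "ball b e \<subseteq> I" using openE[OF open_I assms] by blast
  then show ?thesis using that[of e] by (simp add: ball_eq_greaterThanLessThan)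
qed

text \<open>If \<open>N\<close> vanishes as well, \<open>Q\<close> is the second arclength derivative of \<open>F\<close> at the zero.\<close>

lemma nonzero_right:
  assumes "b \<in> I" "F b = 0" "k b = 0" "N b \<noteq> 0 \<or> Q \<noteq> 0"
  shows "\<exists>e>0. {b..b + e} \<subseteq> I \<and> (\<forall>x\<in>{b<..b + e}. F x \<noteq> 0)"
proof -
  obtain e0 where e0: "e0 > 0" "{b - e0<..<b + e0} \<subseteq> I" using ball_subset[OF assms(1)] .
  have "\<exists>e>0. \<forall>x\<in>{b<..<b + e}. x \<in> I \<longrightarrow> F x \<noteq> 0"
  proof (cases "N b = 0")
    case False
    then show ?thesis
      using DERIV_nonzero_imp_nonzero_right[OF DERIV_F[OF assms(1)]] assms(2) v_pos[OF assms(1)]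
      by (metis mult_eq_0_iff less_irrefl)
  next
    case True
    have "v b * (Q - P * k b - (\<kappa> + \<eta> * (k b)^2 / 2) * F b) \<noteq> 0"
      using True assms v_pos[OF assms(1)] by simp
    from DERIV_nonzero_imp_nonzero_right[OF DERIV_N[OF assms(1)] this True]
    obtain e where e: "e > 0" "\<And>x. x \<in> {b<..<b + e} \<Longrightarrow> N x \<noteq> 0" by blast
    have "F x \<noteq> 0" if x: "x \<in> {b<..<b + e}" "x \<in> I" for x
    proof -
      have "\<exists>z>b. z < x \<and> F x - F b = (x - b) * (v z * N z)"
        using x interval_subset[OF assms(1) x(2)] by (intro MVT2 DERIV_F) auto
      then obtain z where z: "b < z" "z < x" "F x - F b = (x - b) * (v z * N z)" by blast
      then have "z \<in> I" using interval_subset[OF assms(1) x(2)] by auto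
      then show ?thesis using z x e(2)[of z] v_pos[of z] assms(2) by auto
    qed
    then show ?thesis using e(1) by blast
  qed
  then obtain e where e: "e > 0" "\<And>x. x \<in> {b<..<b + e} \<Longrightarrow> x \<in> I \<Longrightarrow> F x \<noteq> 0" by blast
  show ?thesis
    using e e0 by (intro exI[of _ "min e e0 / 2"]) (auto simp: subset_iff min_def)
qed

lemma extend_right:
  assumes "a \<le> b" "a \<in> I" "b \<in> I" "\<rho> \<noteq> 0" "\<And>x. x \<in> {a..b} \<Longrightarrow> F x = \<rho> * k x" and "F a \<noteq> 0"
  shows "\<exists>e>0. \<forall>x\<in>{b..b + e}. F x = \<rho> * k x"
proof (cases "F b = 0")
  case False
  obtain e0 where e0: "e0 > 0" "{b - e0<..<b + e0} \<subseteq> I" using ball_subset[OF assms(3)] .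
  have "isCont F b" using DERIV_F[OF assms(3)] DERIV_isCont by blast
  then obtain e1 where e1: "e1 > 0" "\<And>x. \<bar>x - b\<bar> < e1 \<Longrightarrow> F x \<noteq> 0"
    using continuous_at_avoid[of b F 0] False by (auto simp: dist_real_def abs_minus_commute)
  define e where "e = min e0 e1 / 2"
  have e: "e > 0" "{b..b + e} \<subseteq> I" "\<And>x. x \<in> {b..b + e} \<Longrightarrow> F x \<noteq> 0"
    using e0 e1 by (auto simp: e_def subset_iff min_def split: if_splits)
  obtain c where c: "\<And>x. x \<in> {b..b + e} \<Longrightarrow> k x = c * F x"
    using ratio_constant[OF convex_real_interval(5) e(2,3)] by blast
  have "F b = \<rho> * k b" "k b = c * F b" using c[of b] assms(5)[of b] assms(1) e(1) by auto
  then have "\<rho> * c = 1" using False by (metis mult.assoc mult_cancel_right1)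
  then have "F x = \<rho> * k x" if "x \<in> {b..b + e}" for x
    using c[OF that] by (metis mult.assoc mult_1)
  then show ?thesis using e(1) by blast
next
  case True
  have kb: "k b = 0" using True assms(4) assms(5)[of b] assms(1) by auto
  have ab: "a < b" using True assms(1,6) by (cases "a = b") auto
  have abI: "{a..b} \<subseteq> I" using interval_subset assms by blast
  have NQ: "N b \<noteq> 0 \<or> Q \<noteq> 0" using no_double_zero assms True by blast
  obtain e where e: "e > 0" "{b..b + e} \<subseteq> I" "\<And>x. x \<in> {b<..b + e} \<Longrightarrow> F x \<noteq> 0"
    using nonzero_right[OF assms(3) True kb NQ] by blast
  obtain c where c0: "\<And>x. x \<in> {b<..b + e} \<Longrightarrow> k x = c * F x"
  proof -
    have "{b<..b + e} \<subseteq> I" using e(2) by auto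
    from ratio_constant[OF convex_real_interval(6) this e(3)]
    obtain c where "\<forall>x\<in>{b<..b + e}. k x = c * F x" ..
    then show ?thesis using that[of c] by blast
  qed
  have c: "\<And>x. x \<in> {b..b + e} \<Longrightarrow> k x = c * F x"
  proof -
    fix x assume "x \<in> {b..b + e}"
    then show "k x = c * F x" using c0[of x] kb True by (cases "x = b") auto
  qed
  have left: "\<And>x. x \<in> {a..b} \<Longrightarrow> k x = inverse \<rho> * F x" using assms(4,5) by simp
  \<comment> \<open>Both one-sided ratios of \<open>k\<close> to \<open>F\<close> equal the ratio of the first derivatives at \<open>b\<close>, or of the
    second ones if the first vanish.\<close>
  have "c = inverse \<rho>"
  proof (cases "N b = 0")
    case False
    then show ?thesis
      using proportional_derivatives(1)[OF ab abI left, of b]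
        proportional_derivatives(1)[OF _ e(2) c, of b] e(1) ab by simp
  next
    case True
    then have "Q \<noteq> 0" using NQ by simp
    then show ?thesis
      using proportional_derivatives(2)[OF ab abI left, of b] kb \<open>F b = 0\<close> v_pos[OF assms(3)]
        proportional_derivatives(2)[OF _ e(2) c, of b] e(1) ab by simp
  qed
  then show ?thesis using c e(1) assms(4) by (intro exI[of _ e]) simp
qed

lemma proportional_right:
  assumes "a \<in> I" "y \<in> I" "a \<le> y" "\<rho> \<noteq> 0" "F a = \<rho> * k a" "F a \<noteq> 0"
  shows "F y = \<rho> * k y"
proof -
  define A where "A = {z \<in> {a..y}. \<forall>x\<in>{a..z}. F x = \<rho> * k x}"
  define b where "b = Sup A"
  have ay: "{a..y} \<subseteq> I" using interval_subset assms by blast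
  have aA: "a \<in> A" using assms by (simp add: A_def)
  have Ay: "\<And>z. z \<in> A \<Longrightarrow> z \<le> y" by (simp add: A_def)
  then have bdd: "bdd_above A" by (rule bdd_aboveI)
  have b: "a \<le> b" "b \<le> y"
    unfolding b_def using aA Ay bdd by (blast intro: cSup_upper cSup_least)+
  have bI: "b \<in> I" using ay b by auto
  have below: "F x = \<rho> * k x" if x: "a \<le> x" "x < b" for x
  proof -
    obtain z where "z \<in> A" "x < z" using x aA bdd less_cSup_iff[of A x] unfolding b_def by blast
    then show ?thesis using x by (auto simp: A_def)
  qed
  have "F b = \<rho> * k b"
  proof (cases "a = b")
    case False
    then have "a < b" using b by simp
    have clos: "closure {a<..<b} = {a..b}" using \<open>a < b\<close> by simp
    have "F b - \<rho> * k b = 0"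
    proof (rule continuous_constant_on_closure[where S = "{a<..<b}" and f = "\<lambda>x. F x - \<rho> * k x"])
      have abI: "{a..b} \<subseteq> I" using b ay by auto
      show "continuous_on (closure {a<..<b}) (\<lambda>x. F x - \<rho> * k x)"
        unfolding clos by (intro continuous_intros continuous_on_subset[OF continuous(1) abI]
            continuous_on_subset[OF continuous(3) abI])
      show "F x - \<rho> * k x = 0" if "x \<in> {a<..<b}" for x
        using below[of x] that by simp
      show "b \<in> closure {a<..<b}" unfolding clos using b by simp
    qed
    then show ?thesis by simp
  qed (use assms in auto)
  with below have upto: "\<And>x. x \<in> {a..b} \<Longrightarrow> F x = \<rho> * k x"
    by (metis atLeastAtMost_iff less_eq_real_def)
  obtain e where e: "e > 0" "\<And>x. x \<in> {b..b + e} \<Longrightarrow> F x = \<rho> * k x"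
    using extend_right[OF b(1) assms(1) bI assms(4) upto assms(6)] by blast
  have "min y (b + e) \<in> A"
  proof -
    have "F x = \<rho> * k x" if "x \<in> {a..min y (b + e)}" for x
      using that by (cases "x \<le> b") (auto intro: upto e(2))
    then show ?thesis using b e(1) by (simp add: A_def)
  qed
  then have "min y (b + e) \<le> b" unfolding b_def using bdd by (intro cSup_upper)
  then have "b = y" using e(1) b by (simp add: min_def split: if_splits)
  then show ?thesis using upto b by auto
qed

text \<open>To the left of \<open>a\<close> the previous lemma applies to the system reflected in the origin.\<close>

lemma proportional_everywhere:
  assumes "a \<in> I" "y \<in> I" "\<rho> \<noteq> 0" "F a = \<rho> * k a" "k a \<noteq> 0"
  shows "F y = \<rho> * k y"
proof (cases "a \<le> y")
  case False
  interpret reflected: wronskian_system "uminus ` I" "\<lambda>x. F (- x)" "\<lambda>x. - N (- x)" "\<lambda>x. k (- x)"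
    "\<lambda>x. - m (- x)" "\<lambda>x. v (- x)" \<kappa> \<eta> P Q
  proof
    show "open (uminus ` I)" using open_I open_negations by blast
    show "is_interval (uminus ` I)" using interval_I by simp
  next
    fix x assume "x \<in> uminus ` I"
    then have x: "- x \<in> I" by auto
    show "((\<lambda>x. F (- x)) has_real_derivative v (- x) * - N (- x)) (at x)"
      using DERIV_F[OF x] by (simp add: DERIV_mirror)
    show "((\<lambda>x. k (- x)) has_real_derivative v (- x) * - m (- x)) (at x)"
      using DERIV_k[OF x] by (simp add: DERIV_mirror)
    show "((\<lambda>x. - N (- x)) has_real_derivative
      v (- x) * (Q - P * k (- x) - (\<kappa> + \<eta> * (k (- x))\<^sup>2 / 2) * F (- x))) (at x)"
      using DERIV_minus[OF iffD1[OF DERIV_mirror DERIV_N[OF x]]] by simp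
    show "(\<lambda>x. - m (- x)) differentiable at x"
      using differentiable_m[OF x]
      by (auto intro!: derivative_intros differentiable_chain_at[of uminus x m, unfolded comp_def])
    show "v (- x) > 0" using v_pos[OF x] .
    show "k (- x) * - N (- x) = - m (- x) * F (- x)" using wronskian[OF x] by simp
  next
    show "continuous_on (uminus ` I) (\<lambda>x. v (- x))"
      by (rule continuous_on_compose2[OF continuous_v]) (auto intro!: continuous_intros)
  qed
  have "F (- (- y)) = \<rho> * k (- (- y))"
    by (rule reflected.proportional_right[of "- a"]) (use assms False in auto)
  then show ?thesis by simp
next
  case True
  then show ?thesis using assms by (intro proportional_right[of a y]) auto
qed

text \<open>The set where \<open>k = k a\<close> and \<open>F = 0\<close> is open and closed in \<open>I\<close>: near such a point \<open>F\<close> and \<open>N\<close> vanish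
  identically, and the equation for \<open>N\<close> reduces to \<open>Q = P k\<close>.\<close>

lemma constant_of_zero:
  assumes "a \<in> I" "y \<in> I" "F a = 0" "k a \<noteq> 0" "P \<noteq> 0 \<or> Q \<noteq> 0"
  shows "k y = k a"
proof -
  define A where "A = {x \<in> I. k x = k a \<and> F x = 0}"
  have "connected I" using interval_I is_interval_connected_1 by blast
  moreover have "closedin (top_of_set I) A"
  proof -
    have "A = (I \<inter> k -` {k a}) \<inter> (I \<inter> F -` {0})" by (auto simp: A_def)
    then show ?thesis using continuous continuous_closedin_preimage by blast
  qed
  moreover have "openin (top_of_set I) A"
  proof -
    have nhd: "\<exists>e>0. {b - e<..<b + e} \<subseteq> A" if "b \<in> A" for b
    proof -
      have b: "b \<in> I" "k b = k a" "F b = 0" using that by (auto simp: A_def)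
      obtain e0 where e0: "e0 > 0" "{b - e0<..<b + e0} \<subseteq> I" using ball_subset[OF b(1)] .
      have "isCont k b" using DERIV_k[OF b(1)] DERIV_isCont by blast
      then obtain e1 where e1: "e1 > 0" "\<And>x. \<bar>x - b\<bar> < e1 \<Longrightarrow> k x \<noteq> 0"
        using continuous_at_avoid[of b k 0] b assms by (auto simp: dist_real_def abs_minus_commute)
      define e where "e = min e0 e1"
      have e: "e > 0" "{b - e<..<b + e} \<subseteq> I" "\<And>x. x \<in> {b - e<..<b + e} \<Longrightarrow> k x \<noteq> 0"
      proof -
        show "e > 0" using e0 e1 by (simp add: e_def)
        have "{b - e<..<b + e} \<subseteq> {b - e0<..<b + e0}" by (auto simp: e_def)
        then show "{b - e<..<b + e} \<subseteq> I" using e0(2) by blast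
        show "k x \<noteq> 0" if "x \<in> {b - e<..<b + e}" for x
          using that by (intro e1(2)) (auto simp: e_def abs_less_iff)
      qed
      obtain c where c: "\<And>x. x \<in> {b - e<..<b + e} \<Longrightarrow> F x = c * k x"
        using ratio_constant_inverse[OF convex_real_interval(8) e(2,3)] by blast
      have "c = 0" using c[of b] b assms e(1) by auto
      then have F: "F x = 0" if "x \<in> {b - e<..<b + e}" for x using c that by simp
      have N: "N x = 0" if x: "x \<in> {b - e<..<b + e}" for x
        using wronskian[of x] e(2,3) x F[OF x] by auto
      have PQ: "Q = P * k x" if x: "x \<in> {b - e<..<b + e}" for x
      proof -
        have xI: "x \<in> I" using e x by auto
        have "(N has_real_derivative 0) (at x)"
          by (rule has_field_derivative_transform_within_open[OF DERIV_const[of 0] _ x]) (simp_all add: N)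
        then have "v x * (Q - P * k x - (\<kappa> + \<eta> * (k x)^2 / 2) * F x) = 0"
          using DERIV_unique[OF DERIV_N[OF xI]] by simp
        then show ?thesis using v_pos[OF xI] F[OF x] by simp
      qed
      have PQ_b: "Q = P * k b" using PQ[of b] e(1) by simp
      have "k x = k b" if "x \<in> {b - e<..<b + e}" for x
      proof -
        have "P * k x = P * k b" using PQ[OF that] PQ_b by linarith
        moreover have "P \<noteq> 0" using PQ_b assms(5) by auto
        ultimately show ?thesis by simp
      qed
      then have "{b - e<..<b + e} \<subseteq> A" using e(2) F b(2) by (auto simp: A_def)
      then show ?thesis using e(1) by blast
    qed
    have "\<exists>T. open T \<and> b \<in> T \<and> T \<subseteq> A" if b: "b \<in> A" for b
    proof -
      obtain e where e: "e > 0" "{b - e<..<b + e} \<subseteq> A" using nhd[OF b] by blast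
      have "open {b - e<..<b + e}" "b \<in> {b - e<..<b + e}" using e(1) by simp_all
      with e(2) show ?thesis by blast
    qed
    then have "open A" by (intro open_subopen[THEN iffD2] ballI)
    then show ?thesis by (intro open_subset) (auto simp: A_def)
  qed
  ultimately have "A = {} \<or> A = I" using connected_clopen by blast
  then show ?thesis using assms by (auto simp: A_def)
qed

end

section \<open>The frame of a Legendre curve in a space form\<close>

text \<open>Nondegeneracy and signature are required only where they are used.\<close>

locale symmetric_form =
  fixes B :: "'v::euclidean_space \<Rightarrow> 'v \<Rightarrow> real"
  assumes bilinear_form: "bilinear B" and sym: "B x y = B y x"
begin

sublocale bounded_bilinear B
  using bilinear_form bilinear_conv_bounded_bilinear by blast

lemmas form_simps = add_left add_right diff_left diff_right scaleR_left scaleR_right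
  minus_left minus_right zero_left zero_right

lemma not_in_span_if_pairing:
  assumes "\<And>s. s \<in> S \<Longrightarrow> B s y = 0" "B z y \<noteq> 0"
  shows "z \<notin> span S"
proof
  assume "z \<in> span S"
  then have "B z y = 0"
    by (induction rule: span_induct_alt) (auto simp: form_simps assms(1))
  with assms(2) show False by simp
qed

end

text \<open>Null vectors \<open>f\<close> (a point) and \<open>t\<close> (its tangent plane) on a common null plane, normalised with respect
  to the point sphere complex \<open>p\<close> and the space form vector \<open>q\<close>.\<close>

locale adapted_planes = symmetric_form B for B :: "'v::euclidean_space \<Rightarrow> 'v \<Rightarrow> real" +
  fixes f t p q :: 'v and \<eta> \<kappa> :: real
  assumes dim: "DIM('v) = 5"
    and gram: "B f f = 0" "B f t = 0" "B t t = 0" "B f p = 0" "B f q = -1" "B t p = -1" "B t q = 0"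
      "B p p = - \<eta>" "B q q = - \<kappa>" "B q p = 0"
begin

lemma gram_sym: "B t f = 0" "B p f = 0" "B q f = -1" "B p t = -1" "B q t = 0" "B p q = 0"
  using gram sym by metis+

text \<open>The coefficients come from inverting the Gram matrix of the frame, which is also
  why the five vectors are independent.\<close>

lemma frame_expansion:
  assumes n: "B n n = 1" "B n f = 0" "B n t = 0" "B n p = 0" "B n q = 0"
  shows "r = (\<kappa> * B r f - B r q) *\<^sub>R f + (\<eta> * B r t - B r p) *\<^sub>R t + B r n *\<^sub>R n
    - B r t *\<^sub>R p - B r f *\<^sub>R q"
proof -
  have n': "B f n = 0" "B t n = 0" "B p n = 0" "B q n = 0" using n sym by metis+
  note G = gram gram_sym n n'
  have "f \<noteq> 0"
  proof
    assume "f = 0"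
    then have "B f q = 0" by (simp only: zero_left)
    with gram(5) show False by simp
  qed
  then have f: "f \<notin> span {}" by simp
  have t: "t \<notin> span {f}" by (rule not_in_span_if_pairing[where y = p]) (use G in auto)
  have nn: "n \<notin> span {t, f}" by (rule not_in_span_if_pairing[where y = n]) (use G in auto)
  have p: "p \<notin> span {n, t, f}" by (rule not_in_span_if_pairing[where y = t]) (use G in auto)
  have q: "q \<notin> span {p, n, t, f}" by (rule not_in_span_if_pairing[where y = f]) (use G in auto)
  have indep: "independent {q, p, n, t, f}"
    by (intro independent_insertI[OF q] independent_insertI[OF p] independent_insertI[OF nn]
        independent_insertI[OF t] independent_insertI[OF f] independent_empty)
  have "t \<notin> {f}" "n \<notin> {t, f}" "p \<notin> {n, t, f}" "q \<notin> {p, n, t, f}"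

    by (rule contra_subsetD[OF span_superset], fact)+
  then have card: "card {q, p, n, t, f} = 5"
    by (simp only: card_insert_disjoint finite_insert finite.emptyI card.empty not_False_eq_True) simp
  have "UNIV \<subseteq> span {q, p, n, t, f}"
    by (rule card_ge_dim_independent[OF subset_UNIV indep]) (simp only: card dim_UNIV dim)
  then have "r \<in> span {q, p, n, t, f}" by blast
  then obtain e d c b a where
    "r - e *\<^sub>R q - d *\<^sub>R p - c *\<^sub>R n - b *\<^sub>R t - a *\<^sub>R f = 0"
    unfolding span_breakdown_eq span_empty by blast
  then have r: "r = a *\<^sub>R f + b *\<^sub>R t + c *\<^sub>R n + d *\<^sub>R p + e *\<^sub>R q"
    by (simp only: diff_eq_eq add.assoc add_0_left)
  have pairings: "B r f = - e" "B r t = - d" "B r n = c" "B r p = - b - \<eta> * d" "B r q = - a - \<kappa> * e"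
    unfolding r by (simp_all add: form_simps G)
  show ?thesis unfolding pairings by (simp add: r)
qed

text \<open>The vectors \<open>e1, e2\<close> below span a negative definite plane in \<open>span {f, t, p, q}\<close>. If \<open>(x,x) \<le> 0\<close>, adding
  \<open>x\<close> would give a three-dimensional space without positive vectors, which must meet the positive
  definite three-space in dimension five.\<close>

lemma normal_spacelike:
  assumes sig: "has_signature B 3 m"
    and x: "x \<noteq> 0" "B x f = 0" "B x t = 0" "B x p = 0" "B x q = 0"
  shows "B x x > 0"
proof (rule ccontr)
  assume "\<not> ?thesis"
  then have neg: "B x x \<le> 0" by simp
  obtain P N where PN: "card P = 3" "independent (P \<union> N)"
    "\<forall>u\<in>P \<union> N. \<forall>v\<in>P \<union> N. u \<noteq> v \<longrightarrow> B u v = 0" "\<forall>u\<in>P. B u u = 1"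
    using sig unfolding has_signature_def by blast
  then have P: "card P = 3" "independent P"
    "\<And>u v. u \<in> P \<Longrightarrow> v \<in> P \<Longrightarrow> u \<noteq> v \<Longrightarrow> B u v = 0" "\<And>u. u \<in> P \<Longrightarrow> B u u = 1"
    using independent_mono[OF PN(2), of P] by auto
  have finP: "finite P" using P(1) by (metis card.infinite zero_neq_numeral)
  have pos: "B u u > 0" if u: "u \<in> span P" "u \<noteq> 0" for u
  proof -
    obtain c where c: "u = (\<Sum>v\<in>P. c v *\<^sub>R v)" using u finP by (auto simp: span_finite)
    have "B u u = (\<Sum>v\<in>P. \<Sum>w\<in>P. B (c v *\<^sub>R v) (c w *\<^sub>R w))"
      by (simp add: c sum_left sum_right) (rule sum.swap)
    also have "\<dots> = (\<Sum>v\<in>P. \<Sum>w\<in>P. if w = v then (c v)^2 else 0)"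
      by (intro sum.cong refl) (auto simp: form_simps P power2_eq_square)
    also have "\<dots> = (\<Sum>v\<in>P. (c v)^2)" using finP by simp
    finally have eq: "B u u = (\<Sum>v\<in>P. (c v)^2)" .
    have "B u u \<noteq> 0"
    proof
      assume "B u u = 0"
      then have "\<forall>v\<in>P. c v = 0" using eq finP by (simp add: sum_nonneg_eq_0_iff)
      then show False using c u by simp
    qed
    moreover have "B u u \<ge> 0" unfolding eq by (simp add: sum_nonneg)
    ultimately show ?thesis by simp
  qed
  have x': "B f x = 0" "B t x = 0" "B p x = 0" "B q x = 0" using x sym by metis+
  \<comment> \<open>The multiples of \<open>f\<close> and \<open>t\<close> are chosen to make the squares equal to \<open>-1\<close>.\<close>
  define e1 where "e1 = q + ((1 - \<kappa>) / 2) *\<^sub>R f"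
  define e2 where "e2 = p + ((1 - \<eta>) / 2) *\<^sub>R t"
  have E: "B e1 e1 = -1" "B e2 e2 = -1" "B e1 e2 = 0" "B e2 e1 = 0"
    "B e1 x = 0" "B e2 x = 0" "B x e1 = 0" "B x e2 = 0"
    by (simp_all add: e1_def e2_def form_simps gram gram_sym x x')
  have e1: "e1 \<notin> span {x}" by (rule not_in_span_if_pairing[where y = e1]) (use E in auto)
  have e2: "e2 \<notin> span {e1, x}" by (rule not_in_span_if_pairing[where y = e2]) (use E in auto)
  have indep: "independent {e2, e1, x}"
    using x(1) by (intro independent_insertI[OF e2] independent_insertI[OF e1]) simp
  have "e1 \<notin> {x}" "e2 \<notin> {e1, x}"
    by (rule contra_subsetD[OF span_superset], fact)+
  then have "card {e2, e1, x} = 3"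
    by (simp only: card_insert_disjoint finite_insert finite.emptyI card.empty not_False_eq_True) simp
  then have "dim (span {e2, e1, x}) = 3" "dim (span P) = 3"
    using indep P by (simp_all add: dim_eq_card_independent)
  moreover have "dim {a + b |a b. a \<in> span {e2, e1, x} \<and> b \<in> span P} \<le> 5"
    by (rule order_trans[OF dim_subset_UNIV]) (simp only: dim)
  ultimately have "dim (span {e2, e1, x} \<inter> span P) \<noteq> 0"
    using dim_sums_Int[OF subspace_span[of "{e2, e1, x}"] subspace_span[of P]] by linarith
  then obtain w where w: "w \<in> span {e2, e1, x}" "w \<in> span P" "w \<noteq> 0"
    unfolding dim_eq_0 by blast
  from w(1) obtain a b c where "w - a *\<^sub>R e2 - b *\<^sub>R e1 - c *\<^sub>R x = 0"
    unfolding span_breakdown_eq span_empty by blast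
  then have "w = c *\<^sub>R x + b *\<^sub>R e1 + a *\<^sub>R e2" by (simp only: diff_eq_eq add.assoc add_0_left)
  then have "B w w = - (a^2) - b^2 + c^2 * B x x"
    by (simp add: form_simps E power2_eq_square)
  also have "\<dots> \<le> 0"
    using mult_nonneg_nonpos[OF zero_le_power2[of c] neg] zero_le_power2[of a] zero_le_power2[of b]
    by linarith
  finally show False using pos[OF w(2,3)] by simp
qed

end

text \<open>The derivative of a combination of the frame vectors, written out by the structure equations, when
  all components except that along \<open>n\<close> cancel.\<close>

lemma frame_cancellation:
  fixes f t n p q :: "'v::real_vector"
  assumes "\<beta> = - (m * v * e)" "\<delta> = - (m * v * g)" "y = m * v * h" "y' = m * v"
  shows "(a *\<^sub>R (v *\<^sub>R n) + \<beta> *\<^sub>R f) + (s *\<^sub>R (- c *\<^sub>R n) + \<delta> *\<^sub>R t)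
    + (m *\<^sub>R (v *\<^sub>R (e *\<^sub>R f + g *\<^sub>R t - h *\<^sub>R p + q)) + z *\<^sub>R n)
    + (w *\<^sub>R 0 + y *\<^sub>R p) - (u *\<^sub>R 0 + y' *\<^sub>R q) = (a * v - s * c + z) *\<^sub>R n"
  by (simp add: assms algebra_simps)

text \<open>A curve in a space form with its tangent plane congruence \<open>t\<close>, unit tangent \<open>n\<close>, speed \<open>v\<close>,
  curvature \<open>k\<close> and the arclength derivative \<open>m\<close> of \<open>k\<close>.\<close>

locale framed_curve = symmetric_form B for B :: "'v::euclidean_space \<Rightarrow> 'v \<Rightarrow> real" +
  fixes I :: "real set" and f t n :: "real \<Rightarrow> 'v" and p q :: 'v and k m v :: "real \<Rightarrow> real"
    and \<eta> \<kappa> :: real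
  assumes open_I: "open I" and interval_I: "is_interval I" and nonempty: "I \<noteq> {}" and q_nonzero: "q \<noteq> 0"
    and adapted: "x \<in> I \<Longrightarrow> adapted_planes B (f x) (t x) p q \<eta> \<kappa>"
    and unit_normal: "x \<in> I \<Longrightarrow> B (n x) (n x) = 1" "x \<in> I \<Longrightarrow> B (n x) (f x) = 0"
      "x \<in> I \<Longrightarrow> B (n x) (t x) = 0" "x \<in> I \<Longrightarrow> B (n x) p = 0" "x \<in> I \<Longrightarrow> B (n x) q = 0"
    and deriv_f: "x \<in> I \<Longrightarrow> (f has_vector_derivative v x *\<^sub>R n x) (at x)"
    and deriv_t: "x \<in> I \<Longrightarrow> (t has_vector_derivative - (k x * v x) *\<^sub>R n x) (at x)"
    and differentiable_n: "x \<in> I \<Longrightarrow> n differentiable (at x)"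
    and deriv_k: "x \<in> I \<Longrightarrow> (k has_real_derivative v x * m x) (at x)"
    and differentiable_m: "x \<in> I \<Longrightarrow> m differentiable (at x)"
    and v_pos: "x \<in> I \<Longrightarrow> v x > 0" and continuous_v: "continuous_on I v"
begin

lemma vanishing_derivative:
  fixes g :: "real \<Rightarrow> real"
  assumes "x \<in> I" "\<And>y. y \<in> I \<Longrightarrow> g y = c" "(g has_real_derivative D) (at x)"
  shows "D = 0"
proof -
  have "(g has_real_derivative 0) (at x)"
    by (rule has_field_derivative_transform_within_open[OF DERIV_const[of c] open_I assms(1)])
      (simp add: assms(2))
  then show ?thesis using DERIV_unique[OF assms(3)] by simp
qed

lemma form_deriv:
  assumes "(g has_vector_derivative g') (at x)" "(h has_vector_derivative h') (at x)"
  shows "((\<lambda>x. B (g x) (h x)) has_real_derivative B (g x) h' + B g' (h x)) (at x)"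
  using has_vector_derivative[OF assms] by (simp add: has_real_derivative_iff_has_vector_derivative)

lemmas gram = adapted_planes.gram[OF adapted] adapted_planes.gram_sym[OF adapted] unit_normal

lemma deriv_n:
  assumes x: "x \<in> I"
  shows "(n has_vector_derivative
    v x *\<^sub>R (- \<kappa> *\<^sub>R f x + (\<eta> * k x) *\<^sub>R t x - k x *\<^sub>R p + q)) (at x)"
proof -
  define d where "d = vector_derivative n (at x)"
  have n: "(n has_vector_derivative d) (at x)"
    unfolding d_def using differentiable_n[OF x] vector_derivative_works by blast
  have const: "((\<lambda>_. c) has_vector_derivative 0) (at x)" for c :: 'v
    by (rule has_vector_derivative_const)
  note G = gram[OF x]
  have "B d p = 0"
    using vanishing_derivative[OF x gram(20) form_deriv[OF n const]] by (simp add: form_simps)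
  moreover have "B d q = 0"
    using vanishing_derivative[OF x gram(21) form_deriv[OF n const]] by (simp add: form_simps)
  moreover have "B d (n x) = 0"
    using vanishing_derivative[OF x gram(17) form_deriv[OF n n]] sym[of d] by simp
  moreover have "B d (f x) = - v x"
    using vanishing_derivative[OF x gram(18) form_deriv[OF n deriv_f[OF x]]] G by (simp add: form_simps)
  moreover have "B d (t x) = k x * v x"
    using vanishing_derivative[OF x gram(19) form_deriv[OF n deriv_t[OF x]]] G by (simp add: form_simps)
  ultimately have "d = v x *\<^sub>R (- \<kappa> *\<^sub>R f x + (\<eta> * k x) *\<^sub>R t x - k x *\<^sub>R p + q)"
    using adapted_planes.frame_expansion[OF adapted[OF x] unit_normal[OF x], of d]
    by (simp add: algebra_simps)
  with n show ?thesis by simp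
qed

text \<open>The Euler-Lagrange equation of constrained elastic curves, \<open>deriv m x / v x\<close> being the second arclength
  derivative of \<open>k\<close>.\<close>

definition elastic :: bool where
  "elastic \<longleftrightarrow> (\<exists>\<mu> l. \<forall>x\<in>I. deriv m x / v x + \<eta> * (k x)^3 / 2 + (\<mu> + \<kappa>) * k x + l = 0)"

lemma elastic_imp_complex:
  assumes elastic
  shows "\<exists>r. r \<noteq> 0 \<and> (\<forall>x\<in>I. B (t x + (k x / 2) *\<^sub>R f x) r = 0)"
proof (cases "\<forall>x\<in>I. k x = 0")
  case True
  \<comment> \<open>The vector constructed below may be zero here, but the circles are the geodesics \<open>t\<close>.\<close>
  then show ?thesis using q_nonzero gram by (intro exI[of _ q]) auto
next
  case False
  then obtain a where a: "a \<in> I" "k a \<noteq> 0" by blast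
  obtain \<mu> l where el:
    "\<And>x. x \<in> I \<Longrightarrow> deriv m x / v x + \<eta> * (k x)^3 / 2 + (\<mu> + \<kappa>) * k x + l = 0"
    using assms unfolding elastic_def by blast
  \<comment> \<open>Its coordinates are those of \<open>frame_expansion\<close> for the products \<open>(R,f) = k\<close>, \<open>(R,t) = - k^2/2\<close>,
    \<open>(R,n) = m\<close>, \<open>(R,p) = \<mu>\<close> and \<open>(R,q) = - l\<close>.\<close>
  define R where "R x = (l + \<kappa> * k x) *\<^sub>R f x + (- \<mu> - \<eta> * (k x)^2 / 2) *\<^sub>R t x + m x *\<^sub>R n x
    + ((k x)^2 / 2) *\<^sub>R p - k x *\<^sub>R q" for x
  have "(R has_vector_derivative 0) (at x)" if x: "x \<in> I" for x
  proof -
    have m: "(m has_real_derivative deriv m x) (at x)"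
      using differentiable_m[OF x] by (simp add: DERIV_deriv_iff_real_differentiable)
    have c1: "((\<lambda>x. l + \<kappa> * k x) has_real_derivative \<kappa> * (v x * m x)) (at x)"
      by (auto intro!: derivative_eq_intros deriv_k[OF x])
    have c2: "((\<lambda>x. - \<mu> - \<eta> * (k x)^2 / 2) has_real_derivative - \<eta> * k x * (v x * m x)) (at x)"
      by (auto intro!: derivative_eq_intros deriv_k[OF x])
    have c3: "((\<lambda>x. (k x)^2 / 2) has_real_derivative k x * (v x * m x)) (at x)"
      by (auto intro!: derivative_eq_intros deriv_k[OF x])
    have dm: "deriv m x = - v x * (\<eta> * (k x)^3 / 2 + (\<mu> + \<kappa>) * k x + l)"
    proof -
      have "deriv m x / v x = - (\<eta> * (k x)^3 / 2 + (\<mu> + \<kappa>) * k x + l)" using el[OF x] by linarith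
      moreover have "deriv m x = v x * (deriv m x / v x)" using v_pos[OF x] by simp
      ultimately show ?thesis by (simp only: mult_minus_left mult_minus_right)
    qed
    define D where "D = ((l + \<kappa> * k x) *\<^sub>R (v x *\<^sub>R n x) + (\<kappa> * (v x * m x)) *\<^sub>R f x)
      + ((- \<mu> - \<eta> * (k x)^2 / 2) *\<^sub>R (- (k x * v x) *\<^sub>R n x) + (- \<eta> * k x * (v x * m x)) *\<^sub>R t x)
      + (m x *\<^sub>R (v x *\<^sub>R (- \<kappa> *\<^sub>R f x + (\<eta> * k x) *\<^sub>R t x - k x *\<^sub>R p + q)) + deriv m x *\<^sub>R n x)
      + (((k x)^2 / 2) *\<^sub>R 0 + (k x * (v x * m x)) *\<^sub>R p)
      - (k x *\<^sub>R 0 + (v x * m x) *\<^sub>R q)"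
    have D: "(R has_vector_derivative D) (at x)"
      unfolding R_def D_def
      by (intro has_vector_derivative_add has_vector_derivative_diff has_vector_derivative_scaleR
          c1 c2 c3 m deriv_f deriv_t deriv_n deriv_k x has_vector_derivative_const)
    have "D = ((l + \<kappa> * k x) * v x - (- \<mu> - \<eta> * (k x)^2 / 2) * (k x * v x) + deriv m x) *\<^sub>R n x"
      unfolding D_def
      by (rule frame_cancellation) (simp_all add: ac_simps)
    also have "(l + \<kappa> * k x) * v x - (- \<mu> - \<eta> * (k x)^2 / 2) * (k x * v x) + deriv m x = 0"
      unfolding dm by (simp add: algebra_simps power2_eq_square power3_eq_cube)
    finally show ?thesis using D by simp
  qed
  then have "\<And>x. x \<in> I \<Longrightarrow> (R has_vector_derivative 0) (at x within I)"
    by (simp add: has_vector_derivative_at_within)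
  moreover have "convex I" using interval_I by (simp add: is_interval_convex)
  ultimately obtain r where r: "\<And>x. x \<in> I \<Longrightarrow> R x = r"
    using has_vector_derivative_zero_constant[of I R] by metis
  have "B (f x) r = k x" if "x \<in> I" for x
    unfolding r[OF that, symmetric] R_def using gram[OF that] sym[of "f x" "n x"] by (simp add: form_simps)
  moreover have "B (t x) r = - ((k x)^2 / 2)" if "x \<in> I" for x
    unfolding r[OF that, symmetric] R_def using gram[OF that] sym[of "t x" "n x"] by (simp add: form_simps)
  ultimately show ?thesis
    using a by (intro exI[of _ r]) (auto simp: form_simps power2_eq_square)
qed

lemma complex_imp_elastic:
  assumes r: "r \<noteq> 0" "\<And>x. x \<in> I \<Longrightarrow> B (t x + (k x / 2) *\<^sub>R f x) r = 0"
  shows elastic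
proof (cases "\<forall>x\<in>I. k x = 0")
  case True
  have "deriv m x = 0" if x: "x \<in> I" for x
  proof -
    have m0: "m y = 0" if y: "y \<in> I" for y
      using vanishing_derivative[OF y, of k 0, OF _ deriv_k[OF y]] True v_pos[OF y] by simp
    show ?thesis
      by (rule vanishing_derivative[OF x m0])
        (use differentiable_m[OF x] in \<open>auto simp: DERIV_deriv_iff_real_differentiable\<close>)
  qed
  then show ?thesis unfolding elastic_def using True by (intro exI[of _ 0]) simp
next
  case False
  then obtain a where a: "a \<in> I" "k a \<noteq> 0" by blast
  define F where "F x = B (f x) r" for x
  define N where "N x = B (n x) r" for x
  define P where "P = B p r"
  define Q where "Q = B q r"
  have T: "B (t x) r = - k x * F x / 2" if "x \<in> I" for x
    using r(2)[OF that] by (simp add: form_simps F_def)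
  have const: "((\<lambda>_. r) has_vector_derivative 0) (at x)" for x :: real
    by (rule has_vector_derivative_const)
  have dF: "(F has_real_derivative v x * N x) (at x)" if x: "x \<in> I" for x
    using form_deriv[OF deriv_f[OF x] const] unfolding F_def N_def by (simp add: form_simps)
  interpret wronskian_system I F N k m v \<kappa> \<eta> P Q
  proof
    fix x assume x: "x \<in> I"
    show "(F has_real_derivative v x * N x) (at x)" by (rule dF[OF x])
    have "B (v x *\<^sub>R (- \<kappa> *\<^sub>R f x + (\<eta> * k x) *\<^sub>R t x - k x *\<^sub>R p + q)) r
      = v x * (Q - P * k x - (\<kappa> + \<eta> * (k x)\<^sup>2 / 2) * F x)"
      by (simp add: form_simps T[OF x] F_def[symmetric] P_def[symmetric] Q_def[symmetric]
          field_simps power2_eq_square)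
    then show "(N has_real_derivative v x * (Q - P * k x - (\<kappa> + \<eta> * (k x)\<^sup>2 / 2) * F x)) (at x)"
      using form_deriv[OF deriv_n[OF x] const] unfolding N_def by (simp only: zero_right add_0_left)
    \<comment> \<open>The Wronskian identity is the derivative of \<open>(t + (k/2) f, r) = 0\<close>.\<close>
    have "((\<lambda>x. B (t x) r + k x * F x / 2) has_real_derivative
        (B (t x) 0 + B (- (k x * v x) *\<^sub>R n x) r) + (v x * m x * F x + v x * N x * k x) / 2) (at x)"
      by (intro DERIV_add form_deriv deriv_t const x DERIV_cdivide DERIV_mult deriv_k dF)
    from vanishing_derivative[OF x _ this, of 0] T
    have "v x * (m x * F x - k x * N x) = 0"
      by (simp add: form_simps N_def[symmetric] field_simps)
    then show "k x * N x = m x * F x" using v_pos[OF x] by simp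
  qed (use open_I interval_I deriv_k differentiable_m v_pos continuous_v in auto)
  show ?thesis
  proof (cases "F a = 0")
    case True
    have "P \<noteq> 0 \<or> Q \<noteq> 0"
    proof (rule ccontr)
      assume PQ: "\<not> ?thesis"
      have "N a = 0" using wronskian[OF a(1)] True a(2) by simp
      moreover have "B (t a) r = 0" using T[OF a(1)] True by simp
      ultimately show False
        using adapted_planes.frame_expansion[OF adapted[OF a(1)] unit_normal[OF a(1)], of r] r(1) True PQ
        by (simp add: F_def N_def P_def Q_def sym[of r])
    qed
    then have kc: "k x = k a" if "x \<in> I" for x using constant_of_zero[OF a(1) that True a(2)] by blast
    have m0: "m y = 0" if y: "y \<in> I" for y
      using vanishing_derivative[OF y kc deriv_k[OF y]] v_pos[OF y] by simp
    have "deriv m x = 0" if x: "x \<in> I" for x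
      by (rule vanishing_derivative[OF x m0])
        (use differentiable_m[OF x] in \<open>auto simp: DERIV_deriv_iff_real_differentiable\<close>)
    then show ?thesis unfolding elastic_def
      by (intro exI[of _ 0] exI[of _ "- (\<eta> * (k a)^3 / 2 + \<kappa> * k a)"]) (simp add: kc)
  next
    case F_a: False
    define \<rho> where "\<rho> = F a / k a"
    have \<rho>: "\<rho> \<noteq> 0" "F a = \<rho> * k a" using a F_a by (auto simp: \<rho>_def)
    have F: "F x = \<rho> * k x" if "x \<in> I" for x
      using proportional_everywhere[OF a(1) that \<rho> a(2)] .
    have N: "N x = \<rho> * m x" if x: "x \<in> I" for x
    proof -
      have "((\<lambda>x. F x - \<rho> * k x) has_real_derivative v x * N x - \<rho> * (v x * m x)) (at x)"
        by (intro DERIV_diff dF DERIV_cmult deriv_k x)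
      from vanishing_derivative[OF x _ this, of 0] F
      have "v x * (N x - \<rho> * m x) = 0" by (simp add: algebra_simps)
      then show ?thesis using v_pos[OF x] by simp
    qed
    have "deriv m x / v x + \<eta> * (k x)^3 / 2 + (P / \<rho> + \<kappa>) * k x + - (Q / \<rho>) = 0" if x: "x \<in> I" for x
    proof -
      have "(m has_real_derivative deriv m x) (at x)"
        using differentiable_m[OF x] by (simp add: DERIV_deriv_iff_real_differentiable)
      then have "((\<lambda>x. N x - \<rho> * m x) has_real_derivative
          v x * (Q - P * k x - (\<kappa> + \<eta> * (k x)\<^sup>2 / 2) * F x) - \<rho> * deriv m x) (at x)"
        by (intro DERIV_diff DERIV_N DERIV_cmult x)
      from vanishing_derivative[OF x _ this, of 0] N
      have "\<rho> * deriv m x = v x * (Q - P * k x - (\<kappa> + \<eta> * (k x)\<^sup>2 / 2) * (\<rho> * k x))"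
        using F[OF x] by simp
      then have "deriv m x = v x * (Q - P * k x - (\<kappa> + \<eta> * (k x)\<^sup>2 / 2) * (\<rho> * k x)) / \<rho>"
        using \<rho>(1) by (simp add: field_simps)
      then show ?thesis using v_pos[OF x] \<rho>(1) by (simp add: field_simps power2_eq_square power3_eq_cube)
    qed
    then show ?thesis unfolding elastic_def by blast
  qed
qed

end

section \<open>Smoothness and immersion of the point sphere map\<close>

lemma smooth_curve_on_local:
  assumes "\<And>x. x \<in> S \<Longrightarrow> \<exists>U. x \<in> U \<and> smooth_curve_on U g"
  shows "smooth_curve_on S g"
  using assms unfolding smooth_curve_on_def by blast

context symmetric_form
begin

lemma times_differentiable_on_form:
  assumes "times_differentiable_on n S g" "times_differentiable_on n S h"
  shows "times_differentiable_on n S (\<lambda>x. B (g x) (h x))"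
  using times_differentiable_on_bilinear[OF bounded_bilinear_axioms assms] .

text \<open>Cramer's rule: a section of a smooth rank two bundle with prescribed products with \<open>p\<close> and \<open>q\<close> is smooth.
  The second section \<open>h\<close> serves only to show that the determinant \<open>\<Delta>\<close> does not vanish.\<close>

lemma smooth_if_in_frame:
  fixes \<sigma> \<tau> g h :: "real \<Rightarrow> 'v" and a b c d :: real
  assumes U: "open U" and smooth: "smooth_curve_on U \<sigma>" "smooth_curve_on U \<tau>"
    and g: "\<And>y. y \<in> U \<Longrightarrow> g y \<in> span {\<sigma> y, \<tau> y} \<and> B (g y) p = a \<and> B (g y) q = b"
    and h: "\<And>y. y \<in> U \<Longrightarrow> h y \<in> span {\<sigma> y, \<tau> y} \<and> B (h y) p = c \<and> B (h y) q = d"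
    and indep: "a * d - b * c \<noteq> 0"
  shows "smooth_curve_on U g"
proof -
  define \<Delta> where "\<Delta> y = B (\<sigma> y) p * B (\<tau> y) q + (- 1) * (B (\<tau> y) p * B (\<sigma> y) q)" for y
  define \<alpha> where "\<alpha> y = (a * B (\<tau> y) q + (- b) * B (\<tau> y) p) * inverse (\<Delta> y)" for y
  define \<beta> where "\<beta> y = (b * B (\<sigma> y) p + (- a) * B (\<sigma> y) q) * inverse (\<Delta> y)" for y
  have *: "\<Delta> y \<noteq> 0 \<and> g y = \<alpha> y *\<^sub>R \<sigma> y + \<beta> y *\<^sub>R \<tau> y" if y: "y \<in> U" for y
  proof -
    obtain u v where gy: "g y = u *\<^sub>R \<sigma> y + v *\<^sub>R \<tau> y"
      using g[OF y] unfolding span_breakdown_eq span_empty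
      by (metis add.commute diff_add_cancel eq_iff_diff_eq_0 singletonD)
    obtain u' v' where hy: "h y = u' *\<^sub>R \<sigma> y + v' *\<^sub>R \<tau> y"
      using h[OF y] unfolding span_breakdown_eq span_empty
      by (metis add.commute diff_add_cancel eq_iff_diff_eq_0 singletonD)
    define s1 s2 t1 t2 where st: "s1 = B (\<sigma> y) p" "s2 = B (\<sigma> y) q" "t1 = B (\<tau> y) p" "t2 = B (\<tau> y) q"
    have e: "a = u * s1 + v * t1" "b = u * s2 + v * t2" "c = u' * s1 + v' * t1" "d = u' * s2 + v' * t2"
      using g[OF y] h[OF y] by (auto simp: gy hy add_left scaleR_left st)
    have \<Delta>: "\<Delta> y = s1 * t2 - t1 * s2" by (simp add: \<Delta>_def st)
    have "a * d - b * c = (u * v' - v * u') * \<Delta> y"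
      unfolding e \<Delta> by (simp add: algebra_simps)
    then have nz: "\<Delta> y \<noteq> 0" using indep by auto
    have "a * t2 - b * t1 = u * \<Delta> y" "b * s1 - a * s2 = v * \<Delta> y"
      unfolding e \<Delta> by (simp_all add: algebra_simps)
    then have "\<alpha> y = u" "\<beta> y = v" using nz by (simp_all add: \<alpha>_def \<beta>_def flip: st)
    then show ?thesis using nz gy by simp
  qed
  have "times_differentiable_on n U g" for n
  proof -
    have \<sigma>: "times_differentiable_on n U \<sigma>" and \<tau>: "times_differentiable_on n U \<tau>"
      using smooth smooth_curve_on_iff_times_differentiable_on[OF U] by blast+
    note td = times_differentiable_on_add times_differentiable_on_bilinear[OF bounded_bilinear_mult]
      times_differentiable_on_const times_differentiable_on_form \<sigma> \<tau>
    have \<Delta>: "times_differentiable_on n U (\<lambda>y. inverse (\<Delta> y))"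
    proof (rule times_differentiable_on_inverse)
      show "times_differentiable_on n U \<Delta>" unfolding \<Delta>_def by (intro td)
    qed (simp add: *)
    have \<alpha>: "times_differentiable_on n U \<alpha>" unfolding \<alpha>_def by (intro td \<Delta>)
    have \<beta>: "times_differentiable_on n U \<beta>" unfolding \<beta>_def by (intro td \<Delta>)
    have "times_differentiable_on n U (\<lambda>y. \<alpha> y *\<^sub>R \<sigma> y + \<beta> y *\<^sub>R \<tau> y)"
      by (intro times_differentiable_on_add
          times_differentiable_on_bilinear[OF bounded_bilinear_scaleR] \<alpha> \<beta> \<sigma> \<tau>)
    then show ?thesis using times_differentiable_on_cong[OF U, of g "\<lambda>y. \<alpha> y *\<^sub>R \<sigma> y + \<beta> y *\<^sub>R \<tau> y"] * by simp
  qed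
  then show ?thesis using smooth_curve_on_iff_times_differentiable_on[OF U] by blast
qed

end

text \<open>A Legendre curve together with its point sphere map \<open>f\<close>, tangent plane congruence \<open>t\<close> and
  curvature \<open>k\<close> in the space form of \<open>p\<close> and \<open>q\<close>.\<close>

locale legendre_lift = symmetric_form B for B :: "'v::euclidean_space \<Rightarrow> 'v \<Rightarrow> real" +
  fixes I :: "real set" and C :: "real \<Rightarrow> 'v set" and p q :: 'v and f t :: "real \<Rightarrow> 'v"
    and k :: "real \<Rightarrow> real"
  assumes dim: "DIM('v) = 5" and sig: "has_signature B 3 2"
    and open_I: "open I" and legendre: "legendre_curve B I C"
    and q_perp_p: "B q p = 0"
    and point: "point_sphere_map B p q I C f" and plane: "tangent_plane_congruence B p q I C t"
    and curvature: "curvature_function I f t k"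
begin

lemma null_plane: "x \<in> I \<Longrightarrow> C x \<in> null_planes B"
  using legendre unfolding legendre_curve_def smooth_null_plane_curve_def by blast

lemma subspace_C: "x \<in> I \<Longrightarrow> subspace (C x)" and null_C: "x \<in> I \<Longrightarrow> u \<in> C x \<Longrightarrow> w \<in> C x \<Longrightarrow> B u w = 0"
  using null_plane unfolding null_planes_def by blast+

lemma point_eq: "x \<in> I \<Longrightarrow> C x \<inter> space_form_point_set B p q = {f x}"
  and plane_eq: "x \<in> I \<Longrightarrow> C x \<inter> space_form_plane_set B p q = {t x}"
  using point plane unfolding point_sphere_map_def tangent_plane_congruence_def by blast+

lemma f_props: assumes "x \<in> I" shows "f x \<in> C x" "B (f x) q = -1" "B (f x) p = 0"
  using point_eq[OF assms] unfolding space_form_point_set_def by blast+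

lemma t_props: assumes "x \<in> I" shows "t x \<in> C x" "B (t x) p = -1" "B (t x) q = 0"
  using plane_eq[OF assms] unfolding space_form_plane_set_def by blast+

lemma adapted: "x \<in> I \<Longrightarrow> adapted_planes B (f x) (t x) p q (- B p p) (- B q q)"
  using f_props[of x] t_props[of x] null_C dim q_perp_p by unfold_locales auto

lemma smooth_f: "smooth_curve_on I f" and smooth_t: "smooth_curve_on I t"
proof -
  have "\<exists>U. x \<in> U \<and> smooth_curve_on U f \<and> smooth_curve_on U t" if x: "x \<in> I" for x
  proof -
    obtain U \<sigma> \<tau> where U: "open U" "x \<in> U" "U \<subseteq> I" "smooth_curve_on U \<sigma>" "smooth_curve_on U \<tau>"
      "\<And>y. y \<in> U \<Longrightarrow> C y = span {\<sigma> y, \<tau> y}"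
      using legendre x unfolding legendre_curve_def smooth_null_plane_curve_def by metis
    have ff: "f y \<in> span {\<sigma> y, \<tau> y} \<and> B (f y) p = 0 \<and> B (f y) q = -1" if "y \<in> U" for y
      using f_props[of y] U(3) that by (auto simp: U(6)[OF that, symmetric])
    have tt: "t y \<in> span {\<sigma> y, \<tau> y} \<and> B (t y) p = -1 \<and> B (t y) q = 0" if "y \<in> U" for y
      using t_props[of y] U(3) that by (auto simp: U(6)[OF that, symmetric])
    have "smooth_curve_on U f" by (rule smooth_if_in_frame[OF U(1,4,5) ff tt]) auto
    moreover have "smooth_curve_on U t" by (rule smooth_if_in_frame[OF U(1,4,5) tt ff]) auto
    ultimately show ?thesis using U(2) by blast
  qed
  then show "smooth_curve_on I f" "smooth_curve_on I t"
    by (intro smooth_curve_on_local; blast)+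
qed

abbreviation f' where "f' x \<equiv> vector_derivative f (at x)"
abbreviation t' where "t' x \<equiv> vector_derivative t (at x)"

lemma smooth_imp_has_derivative:
  fixes g :: "real \<Rightarrow> 'v"
  assumes "smooth_curve_on I g" "x \<in> I"
  shows "(g has_vector_derivative vector_derivative g (at x)) (at x)"
  using assms unfolding smooth_curve_on_def by (metis funpow_0 vector_derivative_works)

lemmas has_f' = smooth_imp_has_derivative[OF smooth_f] and has_t' = smooth_imp_has_derivative[OF smooth_t]

lemma t'_eq: "x \<in> I \<Longrightarrow> t' x = - (k x *\<^sub>R f' x)"
  using curvature unfolding curvature_function_def by blast

text \<open>Adding such a vector to \<open>f x\<close> would give a second point of the space form in the plane.\<close>

lemma zero_if_perp:
  assumes x: "x \<in> I" and w: "w \<in> C x" "B w p = 0" "B w q = 0"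
  shows "w = 0"
proof -
  have fw: "f x + w \<in> C x" using subspace_C[OF x] f_props[OF x] w by (simp add: subspace_add)
  have q: "B (f x + w) q = -1" "B (f x + w) p = 0" using f_props[OF x] w by (simp_all add: add_left)
  have "f x + w \<noteq> 0"
  proof
    assume "f x + w = 0"
    with q(1) show False by (simp add: zero_left)
  qed
  then have "f x + w \<in> space_form_point_set B p q"
    using null_C[OF x fw fw] q by (simp add: space_form_point_set_def light_cone_def)
  then have "f x + w = f x" using point_eq[OF x] fw by blast
  then show ?thesis by simp
qed

lemma section_decomposition:
  assumes x: "x \<in> I" and u: "u \<in> C x"
  shows "u = (- B u q) *\<^sub>R f x + (- B u p) *\<^sub>R t x"
proof -
  have "u + B u q *\<^sub>R f x + B u p *\<^sub>R t x = 0"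
  proof (rule zero_if_perp[OF x])
    show "u + B u q *\<^sub>R f x + B u p *\<^sub>R t x \<in> C x"
      using subspace_C[OF x] u f_props[OF x] t_props[OF x] by (intro subspace_add subspace_scale)
  qed (use f_props[OF x] t_props[OF x] in \<open>simp_all add: add_left scaleR_left\<close>)
  then have "u = - (B u q *\<^sub>R f x + B u p *\<^sub>R t x)" by (simp only: eq_neg_iff_add_eq_0 add.assoc)
  then show ?thesis by simp
qed

text \<open>If \<open>f'\<close> vanished, so would \<open>t' = - k f'\<close>, and the derivatives of all sections would stay in the plane,
  against the immersion condition.\<close>

lemma f'_nonzero:
  assumes x: "x \<in> I" shows "f' x \<noteq> 0"
proof
  assume f0: "f' x = 0"
  then have t0: "t' x = 0" using t'_eq[OF x] by simp
  have "1 *\<^sub>R vector_derivative \<sigma> (at x) \<in> C x" if \<sigma>: "\<sigma> \<in> bundle_sections I C" for \<sigma>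
  proof -
    define \<sigma>' where "\<sigma>' = vector_derivative \<sigma> (at x)"
    have sm: "smooth_curve_on I \<sigma>" and inC: "\<And>y. y \<in> I \<Longrightarrow> \<sigma> y \<in> C y"
      using \<sigma> unfolding bundle_sections_def by auto
    have d: "(\<sigma> has_vector_derivative \<sigma>') (at x)"
      unfolding \<sigma>'_def by (rule smooth_imp_has_derivative[OF sm x])
    have pair: "((\<lambda>y. - B (\<sigma> y) c) has_real_derivative - B \<sigma>' c) (at x)" for c
      using has_vector_derivative[OF d has_vector_derivative_const[of c]]
      by (auto simp: has_real_derivative_iff_has_vector_derivative zero_right intro!: has_vector_derivative_minus)
    have "((\<lambda>y. (- B (\<sigma> y) q) *\<^sub>R f y + (- B (\<sigma> y) p) *\<^sub>R t y) has_vector_derivative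
        ((- B (\<sigma> x) q) *\<^sub>R 0 + (- B \<sigma>' q) *\<^sub>R f x) + ((- B (\<sigma> x) p) *\<^sub>R 0 + (- B \<sigma>' p) *\<^sub>R t x)) (at x)"
      using has_f'[OF x] has_t'[OF x] unfolding f0 t0
      by (intro has_vector_derivative_add has_vector_derivative_scaleR pair)
    then have "(\<sigma> has_vector_derivative
        ((- B (\<sigma> x) q) *\<^sub>R 0 + (- B \<sigma>' q) *\<^sub>R f x) + ((- B (\<sigma> x) p) *\<^sub>R 0 + (- B \<sigma>' p) *\<^sub>R t x)) (at x)"
      by (rule has_vector_derivative_transform_within_open[OF _ open_I x])
        (rule section_decomposition[OF _ inC, symmetric])
    from vector_derivative_unique_at[OF d this]
    have "\<sigma>' = (- B \<sigma>' q) *\<^sub>R f x + (- B \<sigma>' p) *\<^sub>R t x"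
      by (simp only: scaleR_zero_right add_0_left)
    also have "\<dots> \<in> C x"
      using subspace_C[OF x] f_props(1)[OF x] t_props(1)[OF x] by (intro subspace_add subspace_scale)
    finally show ?thesis by (simp add: \<sigma>'_def)
  qed
  moreover have "(\<forall>\<sigma>\<in>bundle_sections I C. 1 *\<^sub>R vector_derivative \<sigma> (at x) \<in> C x) \<longrightarrow> (1::real) = 0"
    using legendre x unfolding legendre_curve_def by blast
  ultimately show False by simp
qed

lemma f'_perp:
  assumes x: "x \<in> I"
  shows "B (f' x) (f x) = 0" "B (f' x) (t x) = 0" "B (f' x) p = 0" "B (f' x) q = 0"
proof -
  have "f \<in> bundle_sections I C" using smooth_f f_props by (simp add: bundle_sections_def)
  then have "f' x \<in> derived_fibre I C x" unfolding derived_fibre_def by blast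
  then have "f' x \<in> perp B (C x)" using legendre x unfolding legendre_curve_def by blast
  then show "B (f' x) (f x) = 0" "B (f' x) (t x) = 0"
    using f_props[OF x] t_props[OF x] unfolding perp_def by blast+
  have "B (f' x) c = 0" if "\<And>y. y \<in> I \<Longrightarrow> B (f y) c = a" for a c
  proof -
    have "((\<lambda>y. B (f y) c) has_vector_derivative B (f' x) c) (at x)"
      using has_vector_derivative[OF has_f'[OF x] has_vector_derivative_const[of c]] by (simp add: zero_right)
    moreover have "((\<lambda>y. B (f y) c) has_vector_derivative 0) (at x)"
      by (rule has_vector_derivative_transform_within_open[OF has_vector_derivative_const[of a] open_I x])
        (simp add: that)
    ultimately show ?thesis by (rule vector_derivative_unique_at)
  qed
  from this[of p 0] this[of q "-1"] show "B (f' x) p = 0" "B (f' x) q = 0" using f_props by blast+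
qed

lemma f'_spacelike: "x \<in> I \<Longrightarrow> B (f' x) (f' x) > 0"
  using adapted_planes.normal_spacelike[OF adapted sig f'_nonzero f'_perp] by blast

lemma speed_eq: "x \<in> I \<Longrightarrow> speed B f x = sqrt (B (f' x) (f' x))"
  using f'_spacelike[of x] by (simp add: speed_def)

lemma speed_pos: "x \<in> I \<Longrightarrow> speed B f x > 0"
  using f'_spacelike by (simp add: speed_eq)

lemma k_eq: "x \<in> I \<Longrightarrow> k x = - B (t' x) (f' x) * inverse (B (f' x) (f' x))"
  using f'_spacelike[of x] by (simp add: t'_eq minus_left scaleR_left)

lemma smooth_derivative:
  fixes g :: "real \<Rightarrow> 'v"
  assumes "smooth_curve_on I g"
  shows "times_differentiable_on n I (\<lambda>x. vector_derivative g (at x))"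
proof -
  obtain g' where g': "\<And>x. x \<in> I \<Longrightarrow> (g has_vector_derivative g' x) (at x)" "times_differentiable_on n I g'"
    using assms smooth_curve_on_iff_times_differentiable_on[OF open_I, of g]
    by (metis times_differentiable_on.simps(2))
  have "vector_derivative g (at x) = g' x" if "x \<in> I" for x
    using g'(1)[OF that] by (rule vector_derivative_at)
  then have "times_differentiable_on n I (\<lambda>x. vector_derivative g (at x)) \<longleftrightarrow>
      times_differentiable_on n I g'"
    by (rule times_differentiable_on_cong[OF open_I])
  with g'(2) show ?thesis by blast
qed

lemma times_differentiable_k: "times_differentiable_on n I k"
proof -
  have "times_differentiable_on n I (\<lambda>x. (- 1) * (B (t' x) (f' x) * inverse (B (f' x) (f' x))))"
    by (intro times_differentiable_on_bilinear[OF bounded_bilinear_mult] times_differentiable_on_const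
        times_differentiable_on_form times_differentiable_on_inverse smooth_derivative smooth_f smooth_t)
      (use f'_spacelike in force)
  moreover have "times_differentiable_on n I k \<longleftrightarrow>
      times_differentiable_on n I (\<lambda>x. (- 1) * (B (t' x) (f' x) * inverse (B (f' x) (f' x))))"
    by (rule times_differentiable_on_cong[OF open_I]) (simp add: k_eq)
  ultimately show ?thesis by blast
qed

lemma times_differentiable_imp_differentiable:
  "times_differentiable_on (Suc n) S g \<Longrightarrow> x \<in> S \<Longrightarrow> g differentiable (at x)"
  by (auto intro: differentiableI_vector)

lemma differentiable_f': "x \<in> I \<Longrightarrow> f' differentiable (at x)"
  using times_differentiable_imp_differentiable[OF smooth_derivative[OF smooth_f, of "Suc 0"]] .

lemma differentiable_speed:
  assumes x: "x \<in> I" shows "speed B f differentiable (at x)"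
proof -
  have "(\<lambda>x. B (f' x) (f' x)) differentiable (at x)"
    using times_differentiable_imp_differentiable[OF times_differentiable_on_form[OF
        smooth_derivative[OF smooth_f, of "Suc 0"] smooth_derivative[OF smooth_f]] x] .
  then obtain D where "((\<lambda>x. B (f' x) (f' x)) has_real_derivative D) (at x)"
    using real_differentiable_def by blast
  from DERIV_chain2[OF DERIV_real_sqrt[OF f'_spacelike[OF x]] this]
  obtain E where "((\<lambda>x. sqrt (B (f' x) (f' x))) has_real_derivative E) (at x)" by blast
  then have "(speed B f has_real_derivative E) (at x)"
    by (rule has_field_derivative_transform_within_open[OF _ open_I x]) (simp add: speed_eq)
  then show ?thesis using real_differentiable_def by blast
qed

lemma deriv_k: "x \<in> I \<Longrightarrow> (k has_real_derivative deriv k x) (at x)"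
  and differentiable_deriv_k: "x \<in> I \<Longrightarrow> deriv k differentiable (at x)"
proof -
  obtain k' where k': "\<And>x. x \<in> I \<Longrightarrow> (k has_vector_derivative k' x) (at x)" "times_differentiable_on (Suc 0) I k'"
    using times_differentiable_k[of "Suc (Suc 0)"] by (metis times_differentiable_on.simps(2))
  then have k'': "(k has_real_derivative k' x) (at x)" if "x \<in> I" for x
    using that by (simp add: has_real_derivative_iff_has_vector_derivative)
  then have eq: "k' x = deriv k x" if "x \<in> I" for x using that by (metis DERIV_imp_deriv)
  show "x \<in> I \<Longrightarrow> (k has_real_derivative deriv k x) (at x)" using k'' eq by simp
  have "times_differentiable_on (Suc 0) I k' \<longleftrightarrow> times_differentiable_on (Suc 0) I (deriv k)"
    by (rule times_differentiable_on_cong[OF open_I eq])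
  with k'(2) have "times_differentiable_on (Suc 0) I (deriv k)" by blast
  then show "x \<in> I \<Longrightarrow> deriv k differentiable (at x)"
    by (rule times_differentiable_imp_differentiable)
qed

lemma framed_curve_of_legendre_lift:
  assumes "is_interval I" "I \<noteq> {}" "q \<noteq> 0"
  shows "framed_curve B I f t (\<lambda>x. inverse (speed B f x) *\<^sub>R f' x) p q k (arclength_deriv B f k) (speed B f)
     (- B p p) (- B q q)"
proof (intro framed_curve.intro framed_curve_axioms.intro)
  fix x assume x: "x \<in> I"
  have v: "speed B f x > 0" "(speed B f x)\<^sup>2 = B (f' x) (f' x)"
    using speed_pos[OF x] f'_spacelike[OF x] by (simp_all add: speed_eq[OF x])
  show "adapted_planes B (f x) (t x) p q (- B p p) (- B q q)" by (rule adapted[OF x])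
  show "B (inverse (speed B f x) *\<^sub>R f' x) (inverse (speed B f x) *\<^sub>R f' x) = 1"
    using v f'_spacelike[OF x] by (simp add: scaleR_left scaleR_right field_simps power2_eq_square)
  show "B (inverse (speed B f x) *\<^sub>R f' x) (f x) = 0" "B (inverse (speed B f x) *\<^sub>R f' x) (t x) = 0"
    "B (inverse (speed B f x) *\<^sub>R f' x) p = 0" "B (inverse (speed B f x) *\<^sub>R f' x) q = 0"
    using f'_perp[OF x] by (simp_all add: scaleR_left)
  show "(f has_vector_derivative speed B f x *\<^sub>R inverse (speed B f x) *\<^sub>R f' x) (at x)"
    using has_f'[OF x] v by simp
  show "(t has_vector_derivative - (k x * speed B f x) *\<^sub>R inverse (speed B f x) *\<^sub>R f' x) (at x)"
  proof -
    have "- (k x * speed B f x) *\<^sub>R inverse (speed B f x) *\<^sub>R f' x = - (k x *\<^sub>R f' x)"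
      using v by (simp add: mult.assoc)
    then show ?thesis using has_t'[OF x] by (simp only: t'_eq[OF x])
  qed
  show "(\<lambda>x. inverse (speed B f x) *\<^sub>R f' x) differentiable at x"
    using v by (intro differentiable_scaleR differentiable_inverse differentiable_speed differentiable_f' x) auto
  show "(k has_real_derivative speed B f x * arclength_deriv B f k x) (at x)"
    using deriv_k[OF x] v by (simp add: arclength_deriv_def)
  show "arclength_deriv B f k differentiable at x"
    unfolding arclength_deriv_def[abs_def] using v
    by (intro differentiable_divide differentiable_deriv_k differentiable_speed x) auto
  show "speed B f x > 0" by (rule v)
next
  show "continuous_on I (speed B f)"
    using differentiable_speed by (meson continuous_at_imp_continuous_on differentiable_imp_continuous_within)
qed (fact symmetric_form_axioms open_I assms)+

end

section \<open>Constrained elastic curves and linear circle complexes\<close>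

theorem theorem3p13:
  fixes B :: "real ^ 5 \<Rightarrow> real ^ 5 \<Rightarrow> real"
    and I :: "real set"
    and C :: "real \<Rightarrow> (real ^ 5) set"
    and p q :: "real ^ 5"
    and f t :: "real \<Rightarrow> real ^ 5"
    and k :: "real \<Rightarrow> real"
  assumes "pseudo_metric B 3 2"
    and "open I" and "is_interval I" and "I \<noteq> {}"
    and "legendre_curve B I C"
    and "space_form_sign B p = 1 \<or> space_form_sign B p = -1"
    and "q \<noteq> 0" and "B q p = 0"
    and "point_sphere_map B p q I C f"
    and "tangent_plane_congruence B p q I C t"
    and "curvature_function I f t k"
  shows "(constrained_elastic B p q I f k \<longleftrightarrow>
            (\<exists>L. subspace L \<and> dim L = 1 \<and>
               (\<forall>x\<in>I. circle_congruence f t (\<lambda>y. k y / 2) x \<in> linear_complex B L))) \<and>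
         (constrained_elastic B p q I f k \<longleftrightarrow>
            (\<exists>r. r \<noteq> 0 \<and> (\<forall>x\<in>I. B (t x + (k x / 2) *\<^sub>R f x) r = 0)))"
proof -
  interpret legendre_lift B I C p q f t k
    using assms by unfold_locales (auto simp: pseudo_metric_def)
  interpret framed_curve B I f t "\<lambda>x. inverse (speed B f x) *\<^sub>R f' x" p q k "arclength_deriv B f k"
    "speed B f" "- B p p" "- B q q"
    by (rule framed_curve_of_legendre_lift[OF assms(3,4,7)])
  have "constrained_elastic B p q I f k \<longleftrightarrow> elastic"
    by (simp add: constrained_elastic_def elastic_def arclength_deriv_def[of B f "arclength_deriv B f k"]
        space_form_sign_def space_form_curvature_def)
  then have main: "constrained_elastic B p q I f k \<longleftrightarrow>
      (\<exists>r. r \<noteq> 0 \<and> (\<forall>x\<in>I. B (t x + (k x / 2) *\<^sub>R f x) r = 0))"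
    using elastic_imp_complex complex_imp_elastic by blast
  have complex_iff: "circle_congruence f t (\<lambda>y. k y / 2) x \<in> linear_complex B (span {r}) \<longleftrightarrow>
      B (t x + (k x / 2) *\<^sub>R f x) r = 0" if x: "x \<in> I" for x r
  proof -
    define c where "c = t x + (k x / 2) *\<^sub>R f x"
    have "B c p = -1" using t_props[OF x] f_props[OF x] by (simp add: c_def add_left scaleR_left)
    then have "c \<noteq> 0" by (auto simp: zero_left)
    moreover have "c \<in> C x"
      using subspace_C[OF x] t_props(1)[OF x] f_props(1)[OF x] unfolding c_def
      by (intro subspace_add subspace_scale)
    ultimately have "c \<in> light_cone B" using null_C[OF x] by (simp add: light_cone_def)
    then have "span {c} \<in> proj_light_cone B" unfolding proj_light_cone_def by blast
    moreover have "span {c} \<subseteq> perp B (span {r}) \<longleftrightarrow> B c r = 0"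
    proof
      assume "span {c} \<subseteq> perp B (span {r})"
      then have "c \<in> perp B (span {r})" using span_base[of c "{c}"] by blast
      then show "B c r = 0" using span_base[of r "{r}"] unfolding perp_def by blast
    next
      assume "B c r = 0"
      then show "span {c} \<subseteq> perp B (span {r})"
        by (auto simp: perp_def span_singleton scaleR_left scaleR_right)
    qed
    ultimately show ?thesis unfolding circle_congruence_def linear_complex_def c_def by blast
  qed
  have "(\<exists>L. subspace L \<and> dim L = 1 \<and>
          (\<forall>x\<in>I. circle_congruence f t (\<lambda>y. k y / 2) x \<in> linear_complex B L)) \<longleftrightarrow>
      (\<exists>r. r \<noteq> 0 \<and> (\<forall>x\<in>I. B (t x + (k x / 2) *\<^sub>R f x) r = 0))" (is "?L \<longleftrightarrow> ?R")
  proof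
    assume ?L
    then obtain L where L: "subspace L" "dim L = 1"
      "\<forall>x\<in>I. circle_congruence f t (\<lambda>y. k y / 2) x \<in> linear_complex B L" by blast
    obtain b where b: "b \<subseteq> L" "independent b" "L \<subseteq> span b" "card b = 1"
      using basis_exists[of L] L(2) by metis
    then obtain r where r: "b = {r}" by (metis card_1_singletonE)
    then have "L = span {r}" "r \<noteq> 0" using b L(1) span_minimal[of b L] by auto
    then show ?R using L(3) complex_iff by (intro exI[of _ r]) simp
  next
    assume ?R
    then obtain r where r: "r \<noteq> 0" "\<forall>x\<in>I. B (t x + (k x / 2) *\<^sub>R f x) r = 0" by blast
    have "dim (span {r}) = 1" using r(1) dim_eq_card_independent[of "{r}"] by simp
    then show ?L using r(2) complex_iff by (intro exI[of _ "span {r}"]) simp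
  qed
  with main show ?thesis by blast
qed

end
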